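(* Let $j$ be an integer, let $\boldsymbol{\mu}$ be an $\boldsymbol{l}$-partition of $\boldsymbol{m}$, and let $\boldsymbol{\gamma}=(\gamma_1,\ldots,\gamma_n)$ where $\gamma_h$ is the order of $a_{\mu^{(h)},l_h}^{j}$. Let $\sigma\in S_m$ have cycle type $\rho_\sigma$. Then the tabloids $\{\boldsymbol{T}\}\in\mathcal{T}(\boldsymbol{\mu})$ satisfying $\sigma\{\boldsymbol{T}\}=\{\boldsymbol{T}\}a_{\boldsymbol{\mu},\boldsymbol{l}}^{-j}$ are parameterized by (i.e. are in bijection with) the marked $(\rho_\sigma,\boldsymbol{\gamma},\boldsymbol{l})$-tabloids on $\boldsymbol{\mu}$.
   Context: A partition $\mu$ is identified with its Young diagram $\{(i,j)\in\mathbb{N}^2:1\le j\le\mu_i\}$ (box $(i,j)$ in row $i$, column $j$). For a positive integer $l$, $\mu$ is an $l$-partition if for every $i$ the number of $k$ with $\mu_k=i$ is divisible by $l$. Fix $n$-tuples $\boldsymbol{m}=(m_h)$, $\boldsymbol{l}=(l_h)$ of positive integers, $m=\sum_h m_h$, $l=\operatorname{lcm}(l_h)$. An $\boldsymbol{l}$-partition of $\boldsymbol{m}$ is $\boldsymbol{\mu}=(\mu^{(1)},\ldots,\mu^{(n)})$ with $\mu^{(h)}$ an $l_h$-partition of $m_h$; its boxes are triples $(i,j;h)$, $(i,j)\in\mu^{(h)}$. A numbering on $\boldsymbol{\mu}$ is a bijection $\boldsymbol{T}$ from the boxes to $\{1,\ldots,m\}$; the standard numbering $\boldsymbol{t}_{\boldsymbol{\mu}}$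 fills $1,\ldots,m$ row by row left to right, top to bottom, in $\mu^{(1)}$, then $\mu^{(2)}$, etc. Numberings are row-equivalent if each row of each component contains the same set of numbers; the class $\{\boldsymbol{T}\}$ is a tabloid; $\mathcal{T}(\boldsymbol{\mu})$ is the set of tabloids. $S_m$ acts on the left by $\sigma\{\boldsymbol{T}\}=\{\sigma\circ\boldsymbol{T}\}$. For a single $l$-partition $\mu$ with standard numbering $t_\mu$, $a_{\mu,l}$ is the product over boxes $(lq+1,j)\in\mu$ of the cycles $(t_\mu(lq+1,j),\ldots,t_\mu(lq+l,j))$; $a_{\boldsymbol{\mu},\boldsymbol{l}}\in S_m$ is the analogous product over all $h$ and all boxes $(l_hq+1,j;h)$ of the cycles $(\boldsymbol{t}_{\boldsymbol{\mu}}(l_hq+1,j;h),\ldots,\boldsymbol{t}_{\boldsymbol{\mu}}(l_hq+l_h,j;h))$. The group $\langle a_{\boldsymbol{\mu},\boldsymbol{l}}\rangle$ acts on the right: writing $\boldsymbol{T}=\tau_{\boldsymbol{T}}\circ\boldsymbol{t}_{\boldsymbol{\mu}}$ with $\tau_{\boldsymbol{T}}\in S_m$, set $\boldsymbol{T}\sigma=\tau_{\boldsymbol{T}}\sigma\circ\boldsymbol{t}_{\boldsymbol{\mu}}$ and $\{\boldsymbol{T}\}\sigma=\{\boldsymbol{T}\sigma\}$ (concretely, row $\bar r+l_hq$ of $\mu^{(h)}$ in $\boldsymbol{T}a_{\boldsymbol{\mu},\boldsymbol{l}}$ is row $\overline{r+1}+l_hq$ of $\boldsymbol{T}$, residues taken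 in $\{1,\ldots,l_h\}$). For a partition $\rho$ of $m$ and positive integers $\gamma_h\mid l_h$, a $(\rho,\boldsymbol{\gamma},\boldsymbol{l})$-tabloid on $\boldsymbol{\mu}$ is a map $Y$ from the boxes of $\boldsymbol{\mu}$ to $\mathbb{N}$ such that: (i) $|Y^{-1}(k)|=\rho_k$ for all $k$; (ii) for each $k$ there exist $h$ and $(i',j')\in\mathbb{N}^2$ with $\gamma_h\mid\rho_k$ and $Y^{-1}(k)=\{(s\,l_h/\gamma_h+i',t+j';h):1\le s\le\gamma_h,1\le t\le\rho_k/\gamma_h\}$; (iii) $Y(i,j;h)\le Y(i,k;h)$ whenever $j\le k$. A marked $(\rho,\boldsymbol{\gamma},\boldsymbol{l})$-tabloid is a pair $(Y,c)$ with $Y$ such a tabloid and $c:\{i:\rho_i\neq0\}\to\coprod_h\mathbb{Z}/\gamma_h\mathbb{Z}$ with $c(i)\in\mathbb{Z}/\gamma_h\mathbb{Z}$ whenever $Y^{-1}(i)\subset\mu^{(h)}$.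
   Formalization: In condition (ii) the offset (i',j') ranges over pairs of integers instead of ℕ²; with ℕ² no block could meet row 1 when l_h/γ_h ≥ 2, and the claim fails (l=2, μ=(1,1), j=0, σ=id). The number n of components is assumed to be at least 1. *)

theory Defs
  imports
    "HOL-Library.Multiset"
    "HOL-Combinatorics.Cycles"
    "HOL-Combinatorics.Orbits"
    "HOL-Algebra.Sym_Groups"
    "HOL-Algebra.Elementary_Groups"
    "HOL-Algebra.Multiplicative_Group"
begin

section \<open>Partitions\<close>

text \<open>A partition is the weakly decreasing list of its nonzero parts.
  Rows, columns, parts and components are all numbered from 1.\<close>

definition partition_of :: "nat list \<Rightarrow> nat \<Rightarrow> bool" where
  "partition_of \<mu> m \<longleftrightarrow> sorted_wrt (\<ge>) \<mu> \<and> (\<forall>x\<in>set \<mu>. 0 < x) \<and> sum_list \<mu> = m"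

definition part :: "nat list \<Rightarrow> nat \<Rightarrow> nat" where
  "part \<mu> i = (if 1 \<le> i \<and> i \<le> length \<mu> then \<mu> ! (i - 1) else 0)"

definition l_partition_of :: "nat \<Rightarrow> nat list \<Rightarrow> nat \<Rightarrow> bool" where
  "l_partition_of l \<mu> m \<longleftrightarrow> partition_of \<mu> m \<and> (\<forall>i. l dvd count_list \<mu> i)"

definition cycle_type :: "nat \<Rightarrow> (nat \<Rightarrow> nat) \<Rightarrow> nat list" where
  "cycle_type m \<sigma> =
     rev (sorted_list_of_multiset (image_mset card (mset_set (Orbits.orbit \<sigma> ` {1..m}))))"

section \<open>Tuples of partitions, numberings and tabloids\<close>

text \<open>An \<open>n\<close>-tuple is a function on \<open>nat\<close> of which only the values on \<open>{1..n}\<close> are used.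
  The box \<open>(i,j;h)\<close> is the triple \<open>(i, j, h)\<close>.\<close>

type_synonym box = "nat \<times> nat \<times> nat"

definition multi_partition_of ::
  "nat \<Rightarrow> (nat \<Rightarrow> nat) \<Rightarrow> (nat \<Rightarrow> nat list) \<Rightarrow> (nat \<Rightarrow> nat) \<Rightarrow> bool" where
  "multi_partition_of n ls \<mu> ms \<longleftrightarrow> (\<forall>h\<in>{1..n}. l_partition_of (ls h) (\<mu> h) (ms h))"

definition boxes :: "nat \<Rightarrow> (nat \<Rightarrow> nat list) \<Rightarrow> box set" where
  "boxes n \<mu> = {(i, j, h). h \<in> {1..n} \<and> 1 \<le> i \<and> 1 \<le> j \<and> j \<le> part (\<mu> h) i}"

definition total_size :: "nat \<Rightarrow> (nat \<Rightarrow> nat list) \<Rightarrow> nat" where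
  "total_size n \<mu> = (\<Sum>h\<in>{1..n}. sum_list (\<mu> h))"

definition numberings :: "nat \<Rightarrow> (nat \<Rightarrow> nat list) \<Rightarrow> (box \<Rightarrow> nat) set" where
  "numberings n \<mu> =
     {T \<in> extensional (boxes n \<mu>). bij_betw T (boxes n \<mu>) {1..total_size n \<mu>}}"

definition row :: "nat \<Rightarrow> (nat \<Rightarrow> nat list) \<Rightarrow> nat \<Rightarrow> nat \<Rightarrow> box set" where
  "row n \<mu> i h = {b \<in> boxes n \<mu>. \<exists>j. b = (i, j, h)}"

definition row_equiv :: "nat \<Rightarrow> (nat \<Rightarrow> nat list) \<Rightarrow> ((box \<Rightarrow> nat) \<times> (box \<Rightarrow> nat)) set" where
  "row_equiv n \<mu> =
     {(T, T'). T \<in> numberings n \<mu> \<and> T' \<in> numberings n \<mu> \<and>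
        (\<forall>i h. T ` row n \<mu> i h = T' ` row n \<mu> i h)}"

definition tabloid :: "nat \<Rightarrow> (nat \<Rightarrow> nat list) \<Rightarrow> (box \<Rightarrow> nat) \<Rightarrow> (box \<Rightarrow> nat) set" where
  "tabloid n \<mu> T = row_equiv n \<mu> `` {T}"

definition tabloids :: "nat \<Rightarrow> (nat \<Rightarrow> nat list) \<Rightarrow> (box \<Rightarrow> nat) set set" where
  "tabloids n \<mu> = numberings n \<mu> // row_equiv n \<mu>"

section \<open>The permutations \<open>a\<close>\<close>

definition std_num1 :: "nat list \<Rightarrow> nat \<times> nat \<Rightarrow> nat" where
  "std_num1 \<mu> = (\<lambda>(i, j). (\<Sum>r\<in>{1..<i}. part \<mu> r) + j)"

definition std_num :: "nat \<Rightarrow> (nat \<Rightarrow> nat list) \<Rightarrow> box \<Rightarrow> nat" where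
  "std_num n \<mu> =
     (\<lambda>(i, j, h) \<in> boxes n \<mu>. (\<Sum>g\<in>{1..<h}. sum_list (\<mu> g)) + std_num1 (\<mu> h) (i, j))"

text \<open>The cycles attached to the boxes \<open>(l * q + 1, j)\<close> of \<open>\<mu>\<close>. They are pairwise disjoint,
  so the order in which they are multiplied is irrelevant.\<close>

definition column_cycles :: "nat \<Rightarrow> nat list \<Rightarrow> (nat \<times> nat \<Rightarrow> nat) \<Rightarrow> (nat \<Rightarrow> nat) list" where
  "column_cycles l \<mu> t =
     concat (map (\<lambda>q. map (\<lambda>j. cycle_of_list (map (\<lambda>s. t (l * q + s, j)) [1..<l + 1]))
                        [1..<part \<mu> (l * q + 1) + 1])
               [0..<length \<mu>])"

definition a_perm1 :: "nat list \<Rightarrow> nat \<Rightarrow> nat \<Rightarrow> nat" where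
  "a_perm1 \<mu> l = foldr (\<circ>) (column_cycles l \<mu> (std_num1 \<mu>)) id"

definition a_perm :: "nat \<Rightarrow> (nat \<Rightarrow> nat list) \<Rightarrow> (nat \<Rightarrow> nat) \<Rightarrow> nat \<Rightarrow> nat" where
  "a_perm n \<mu> ls =
     foldr (\<circ>)
       (concat (map (\<lambda>h. column_cycles (ls h) (\<mu> h) (\<lambda>(i, j). std_num n \<mu> (i, j, h)))
                  [1..<n + 1])) id"

section \<open>The two actions\<close>

definition left_num ::
  "nat \<Rightarrow> (nat \<Rightarrow> nat list) \<Rightarrow> (nat \<Rightarrow> nat) \<Rightarrow> (box \<Rightarrow> nat) \<Rightarrow> (box \<Rightarrow> nat)" where
  "left_num n \<mu> \<sigma> T = compose (boxes n \<mu>) \<sigma> T"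

definition tau :: "nat \<Rightarrow> (nat \<Rightarrow> nat list) \<Rightarrow> (box \<Rightarrow> nat) \<Rightarrow> (nat \<Rightarrow> nat)" where
  "tau n \<mu> T =
     (THE \<tau>. \<tau> permutes {1..total_size n \<mu>} \<and> T = compose (boxes n \<mu>) \<tau> (std_num n \<mu>))"

definition right_num ::
  "nat \<Rightarrow> (nat \<Rightarrow> nat list) \<Rightarrow> (box \<Rightarrow> nat) \<Rightarrow> (nat \<Rightarrow> nat) \<Rightarrow> (box \<Rightarrow> nat)" where
  "right_num n \<mu> T \<sigma> = compose (boxes n \<mu>) (tau n \<mu> T \<circ> \<sigma>) (std_num n \<mu>)"

text \<open>The induced actions on row-equivalence classes, lifted through representatives.
  The right action is meant only for \<open>\<sigma>\<close> in the group generated by \<open>a_perm n \<mu> ls\<close>,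
  for which it does not depend on the representative.\<close>

definition left_tabloid ::
  "nat \<Rightarrow> (nat \<Rightarrow> nat list) \<Rightarrow> (nat \<Rightarrow> nat) \<Rightarrow> (box \<Rightarrow> nat) set \<Rightarrow> (box \<Rightarrow> nat) set" where
  "left_tabloid n \<mu> \<sigma> X = (\<Union>T\<in>X. tabloid n \<mu> (left_num n \<mu> \<sigma> T))"

definition right_tabloid ::
  "nat \<Rightarrow> (nat \<Rightarrow> nat list) \<Rightarrow> (box \<Rightarrow> nat) set \<Rightarrow> (nat \<Rightarrow> nat) \<Rightarrow> (box \<Rightarrow> nat) set" where
  "right_tabloid n \<mu> X \<sigma> = (\<Union>T\<in>X. tabloid n \<mu> (right_num n \<mu> T \<sigma>))"

section \<open>Marked tabloids\<close>

definition preim :: "nat \<Rightarrow> (nat \<Rightarrow> nat list) \<Rightarrow> (box \<Rightarrow> nat) \<Rightarrow> nat \<Rightarrow> box set" where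
  "preim n \<mu> Y k = {b \<in> boxes n \<mu>. Y b = k}"

text \<open>Coordinates are compared in the integers because the offset \<open>(i', j')\<close> of a block may have
  \<open>i' < 0\<close>: a block meeting row 1 has \<open>i' = 1 - l / \<gamma>\<close>. The division \<open>ls h div \<gamma> h\<close> is exact, as
  these tabloids are only considered for \<open>\<gamma> h\<close> dividing \<open>ls h\<close>.\<close>

definition rho_tabloids ::
  "nat list \<Rightarrow> (nat \<Rightarrow> nat) \<Rightarrow> nat \<Rightarrow> (nat \<Rightarrow> nat) \<Rightarrow> (nat \<Rightarrow> nat list) \<Rightarrow> (box \<Rightarrow> nat) set" where
  "rho_tabloids \<rho> \<gamma> n ls \<mu> =
     {Y \<in> boxes n \<mu> \<rightarrow>\<^sub>E {1..}.
        (\<forall>k\<ge>1. card (preim n \<mu> Y k) = part \<rho> k) \<and>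
        (\<forall>k\<ge>1. \<exists>h\<in>{1..n}. \<exists>i' j' :: int. \<gamma> h dvd part \<rho> k \<and>
           (\<lambda>(i, j, h). (int i, int j, h)) ` preim n \<mu> Y k =
             {(int s * int (ls h div \<gamma> h) + i', int t + j', h) | s t.
                1 \<le> s \<and> s \<le> \<gamma> h \<and> 1 \<le> t \<and> t \<le> part \<rho> k div \<gamma> h}) \<and>
        (\<forall>i j k h. (i, j, h) \<in> boxes n \<mu> \<and> (i, k, h) \<in> boxes n \<mu> \<and> j \<le> k \<longrightarrow>
           Y (i, j, h) \<le> Y (i, k, h))}"

text \<open>The coproduct of the \<open>\<int>/\<gamma>\<^sub>h\<int>\<close> is the set of pairs \<open>(h, x)\<close> with \<open>x\<close> in \<open>\<int>/\<gamma>\<^sub>h\<int>\<close>.\<close>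

definition marked_tabloids ::
  "nat list \<Rightarrow> (nat \<Rightarrow> nat) \<Rightarrow> nat \<Rightarrow> (nat \<Rightarrow> nat) \<Rightarrow> (nat \<Rightarrow> nat list) \<Rightarrow>
     ((box \<Rightarrow> nat) \<times> (nat \<Rightarrow> nat \<times> int)) set" where
  "marked_tabloids \<rho> \<gamma> n ls \<mu> =
     {(Y, c). Y \<in> rho_tabloids \<rho> \<gamma> n ls \<mu> \<and>
        c \<in> {k. part \<rho> k \<noteq> 0} \<rightarrow>\<^sub>E (SIGMA h:{1..n}. carrier (integer_mod_group (\<gamma> h))) \<and>
        (\<forall>k h. part \<rho> k \<noteq> 0 \<and> h \<in> {1..n} \<and> preim n \<mu> Y k \<subseteq> {(i, j, h') | i j h'. h' = h} \<longrightarrow>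
           fst (c k) = h)}"

end

theory Submission
  imports Defs "HOL-Number_Theory.Cong"
begin

text \<open>A tabloid is the same thing as a map \<open>R\<close> from \<open>{1..m}\<close> to the rows of the diagrams with
  prescribed fibre sizes, and the fixed-point condition says that \<open>R (\<sigma> y)\<close> is \<open>R y\<close> rotated by
  \<open>-j\<close> within its group of \<open>l\<^sub>h\<close> equal rows. Such an equivariant map is determined by its values
  at one representative of every cycle of \<open>\<sigma>\<close>. A cycle of length \<open>\<rho>\<^sub>k\<close> starting in a row of
  component \<open>h\<close> meets each of the \<open>\<gamma>\<^sub>h\<close> rows of the rotation class of that row in \<open>\<rho>\<^sub>k / \<gamma>\<^sub>h\<close>
  numbers. Writing, in increasing order, every \<open>k\<close> into each row as often as the \<open>k\<close>-th cycle
  meets it yields \<open>Y\<close>, and the position of the starting row inside its class is the mark.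
  Conversely, since the rows of \<open>Y\<close> are weakly increasing, \<open>Y\<close> is determined by the classes of
  its blocks, and every block spans exactly the rows of one class.\<close>

section \<open>Equivariant maps between permutations\<close>

lemma card_orbit_eq_least_power:
  assumes "permutation f"
  shows "card (orbit f x) = least_power f x"
proof -
  have "orbit f x = set (support f x)"
    unfolding support_set[OF assms] orbit_altdef_permutation[OF assms] by auto
  then show ?thesis
    by (simp only: distinct_card[OF cycle_of_permutation[OF assms]] length_map length_upt)
qed

lemma funpow_eq_self_iff:
  assumes "permutation f"
  shows "(f ^^ e) x = x \<longleftrightarrow> card (orbit f x) dvd e"
  using least_power_dvd[OF assms] by (simp add: card_orbit_eq_least_power[OF assms])

lemma funpow_card_orbit: "permutation f \<Longrightarrow> (f ^^ card (orbit f x)) x = x"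
  by (simp add: funpow_eq_self_iff)

lemma funpow_eq_funpow_iff:
  assumes permutation: "permutation f"
  shows "(f ^^ e) x = (f ^^ e') x \<longleftrightarrow> e mod card (orbit f x) = e' mod card (orbit f x)"
proof (induction e e' rule: linorder_wlog)
  case (le e e')
  have "(f ^^ e') x = (f ^^ e) ((f ^^ (e' - e)) x)"
    using le by (metis comp_apply funpow_add le_add_diff_inverse)
  then have "(f ^^ e) x = (f ^^ e') x \<longleftrightarrow> (f ^^ (e' - e)) x = x"
    using inj_eq[OF inj_fn[OF bij_is_inj[OF permutation_bijective[OF permutation]]]] by metis
  also have "\<dots> \<longleftrightarrow> card (orbit f x) dvd e' - e"
    by (rule funpow_eq_self_iff[OF permutation])
  also have "\<dots> \<longleftrightarrow> e mod card (orbit f x) = e' mod card (orbit f x)"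
    by (metis le mod_eq_dvd_iff_nat)
  finally show ?case .
qed (simp add: eq_commute)

lemma card_orbit_pos: "permutation f \<Longrightarrow> 0 < card (orbit f x)"
  by (simp add: card_gt_0_iff finite_orbit orbit_nonempty permutation_self_in_orbit)

lemma bij_betw_funpow_orbit:
  assumes "permutation f"
  shows "bij_betw (\<lambda>e. (f ^^ e) x) {..<card (orbit f x)} (orbit f x)"
  unfolding bij_betw_def
proof
  show "inj_on (\<lambda>e. (f ^^ e) x) {..<card (orbit f x)}"
    by (rule inj_onI) (simp add: funpow_eq_funpow_iff[OF assms])
  show "(\<lambda>e. (f ^^ e) x) ` {..<card (orbit f x)} = orbit f x"
    using orbit_altdef_bounded[OF funpow_card_orbit card_orbit_pos, OF assms assms] by auto
qed

lemma card_residue_class: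
  fixes N d r :: nat
  assumes "d dvd N" "r < d"
  shows "card {e. e < N \<and> e mod d = r} = N div d"
proof -
  obtain q where N: "N = d * q"
    using assms(1) ..
  have "bij_betw (\<lambda>t. d * t + r) {..<q} {e. e < N \<and> e mod d = r}"
  proof (rule bij_betwI[where g = "\<lambda>e. e div d"])
    have "d * t + r < d * q" if "t < q" for t
    proof -
      have "d * t + r < d * Suc t"
        using assms(2) by simp
      also have "\<dots> \<le> d * q"
        using that by (intro mult_le_mono2) simp
      finally show ?thesis .
    qed
    then show "(\<lambda>t. d * t + r) \<in> {..<q} \<rightarrow> {e. e < N \<and> e mod d = r}"
      using assms(2) by (auto simp: N)
  qed (use assms(2) in \<open>auto simp: N less_mult_imp_div_less mult.commute\<close>)
  from bij_betw_same_card[OF this] show ?thesis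
    using assms(2) by (simp add: N)
qed

lemma card_orbit_fibre:
  assumes permutation_f: "permutation f" and permutation_P: "permutation P"
    and equivariant: "\<And>e. R ((f ^^ e) x) = (P ^^ e) (R x)"
  shows "card {y \<in> orbit f x. R y = p} =
    (if p \<in> orbit P (R x) then card (orbit f x) div card (orbit P (R x)) else 0)"
proof (cases "p \<in> orbit P (R x)")
  case True
  let ?N = "card (orbit f x)" and ?d = "card (orbit P (R x))"
  obtain r where remainder: "r < ?d" "p = (P ^^ r) (R x)"
    using True bij_betw_funpow_orbit[OF permutation_P, of "R x"] by (auto simp: bij_betw_def)
  have "bij_betw (\<lambda>e. (f ^^ e) x) {e \<in> {..<?N}. e mod ?d = r} {y \<in> orbit f x. R y = p}"
    by (rule bij_betw_Collect[OF bij_betw_funpow_orbit[OF permutation_f]])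
      (use remainder in \<open>simp add: equivariant funpow_eq_funpow_iff[OF permutation_P]\<close>)
  then have "card {y \<in> orbit f x. R y = p} = card {e. e < ?N \<and> e mod ?d = r}"
    by (simp add: bij_betw_same_card)
  moreover have "(P ^^ ?N) (R x) = R x"
    using equivariant[of ?N] funpow_card_orbit[OF permutation_f] by metis
  then have "?d dvd ?N"
    using funpow_eq_self_iff[OF permutation_P] by blast
  ultimately show ?thesis
    using card_residue_class[OF _ remainder(1)] True by simp
next
  case False
  have "R y \<in> orbit P (R x)" if "y \<in> orbit f x" for y
    using that equivariant
    by (auto simp: orbit_altdef_permutation[OF permutation_f]
        orbit_altdef_permutation[OF permutation_P])
  then have "{y \<in> orbit f x. R y = p} = {}"
    using False by blast
  with False show ?thesis
    by (simp only: card.empty if_False)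
qed

definition equivariant_maps ::
  "'a set \<Rightarrow> ('a \<Rightarrow> 'a) \<Rightarrow> 'b set \<Rightarrow> ('b \<Rightarrow> 'b) \<Rightarrow> ('a \<Rightarrow> 'b) set" where
  "equivariant_maps D f Z P = {R \<in> D \<rightarrow>\<^sub>E Z. \<forall>x\<in>D. R (f x) = P (R x)}"

locale orbit_representatives =
  fixes f :: "'a \<Rightarrow> 'a" and D :: "'a set" and I :: "'i set" and rep :: "'i \<Rightarrow> 'a"
  assumes permutes: "f permutes D"
    and finite_domain: "finite D"
    and rep_in: "k \<in> I \<Longrightarrow> rep k \<in> D"
    and bij_betw_orbits: "bij_betw (\<lambda>k. orbit f (rep k)) I (orbit f ` D)"
begin

lemma permutation: "permutation f"
  using permutes finite_domain permutation_permutes by blast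

lemma funpow_in: "x \<in> D \<Longrightarrow> (f ^^ e) x \<in> D"
  using permutes_in_image[OF permutes_funpow[OF permutes]] by blast

lemma finite_index: "finite I"
  using bij_betw_finite[OF bij_betw_orbits] finite_domain by simp

lemma orbit_rep_eq:
  assumes "x \<in> orbit f (rep k)"
  shows "orbit f x = orbit f (rep k)"
  by (rule orbit_cyclic_eq3[OF cyclic_on_orbit'[OF permutation] assms])

lemma index_unique:
  assumes "k \<in> I" "k' \<in> I" "x \<in> orbit f (rep k)" "x \<in> orbit f (rep k')"
  shows "k = k'"
proof -
  have "orbit f (rep k) = orbit f (rep k')"
    using orbit_rep_eq[OF assms(3)] orbit_rep_eq[OF assms(4)] by simp
  then show ?thesis
    using inj_onD[OF bij_betw_imp_inj_on[OF bij_betw_orbits]] assms(1,2) by blast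
qed

lemma UN_orbit_rep: "(\<Union>k\<in>I. orbit f (rep k)) = D"
proof -
  have "(\<Union>k\<in>I. orbit f (rep k)) = \<Union> (orbit f ` D)"
    using bij_betw_imp_surj_on[OF bij_betw_orbits] by simp
  also have "\<dots> = D"
    using permutes_orbit_subset[OF permutes] permutation_self_in_orbit[OF permutation] by blast
  finally show ?thesis .
qed

lemma funpow_rep:
  assumes "x \<in> D"
  obtains k e where "k \<in> I" "x = (f ^^ e) (rep k)"
proof -
  obtain k where "k \<in> I" "x \<in> orbit f (rep k)"
    using assms UN_orbit_rep by blast
  then show ?thesis
    using that by (auto simp: orbit_altdef)
qed

lemma funpow_rep_eqD:
  assumes "k \<in> I" "k' \<in> I" "(f ^^ e) (rep k) = (f ^^ e') (rep k')"
  shows "k = k'" and "e mod card (orbit f (rep k)) = e' mod card (orbit f (rep k))"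
proof -
  have "(f ^^ e) (rep k) \<in> orbit f (rep k)" for k e
    by (intro funpow_in_orbit permutation_self_in_orbit permutation)
  then show "k = k'"
    using index_unique[OF assms(1,2)] assms(3) by metis
  then show "e mod card (orbit f (rep k)) = e' mod card (orbit f (rep k))"
    using assms(3) funpow_eq_funpow_iff[OF permutation] by blast
qed

lemma equivariant_funpow:
  assumes "R \<in> equivariant_maps D f Z P" "x \<in> D"
  shows "R ((f ^^ e) x) = (P ^^ e) (R x)"
  using assms funpow_in by (induction e) (simp_all add: equivariant_maps_def)

lemma equivariant_eqI:
  assumes R: "R \<in> equivariant_maps D f Z P" and R': "R' \<in> equivariant_maps D f Z P"
    and eq_rep: "\<And>k. k \<in> I \<Longrightarrow> R (rep k) = R' (rep k)"
  shows "R = R'"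
proof (rule extensionalityI)
  fix x assume "x \<in> D"
  then obtain k e where "k \<in> I" "x = (f ^^ e) (rep k)"
    by (rule funpow_rep)
  then show "R x = R' x"
    using eq_rep rep_in equivariant_funpow[OF R] equivariant_funpow[OF R'] by simp
qed (use R R' in \<open>auto simp: equivariant_maps_def PiE_def\<close>)

lemma orbit_coordinates:
  obtains index exponent where "\<And>x. x \<in> D \<Longrightarrow> index x \<in> I"
    and "\<And>x. x \<in> D \<Longrightarrow> x = (f ^^ exponent x) (rep (index x))"
proof -
  have "\<forall>x\<in>D. \<exists>k. k \<in> I \<and> (\<exists>e. x = (f ^^ e) (rep k))"
    using funpow_rep by metis
  then obtain index where index: "\<forall>x\<in>D. index x \<in> I \<and> (\<exists>e. x = (f ^^ e) (rep (index x)))"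
    by (rule bchoice[THEN exE])
  then have "\<forall>x\<in>D. \<exists>e. x = (f ^^ e) (rep (index x))"
    by blast
  then obtain exponent where "\<forall>x\<in>D. x = (f ^^ exponent x) (rep (index x))"
    by (rule bchoice[THEN exE])
  with index show ?thesis
    using that by blast
qed

lemma equivariant_extension:
  assumes P: "P permutes Z" "permutation P" and F: "F \<in> I \<rightarrow>\<^sub>E Z"
    and dvd: "\<And>k. k \<in> I \<Longrightarrow> card (orbit P (F k)) dvd card (orbit f (rep k))"
  obtains R where "R \<in> equivariant_maps D f Z P" "\<And>k. k \<in> I \<Longrightarrow> R (rep k) = F k"
proof -
  obtain index exponent where coordinates: "\<And>x. x \<in> D \<Longrightarrow> index x \<in> I"
      "\<And>x. x \<in> D \<Longrightarrow> x = (f ^^ exponent x) (rep (index x))"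
    using orbit_coordinates by blast
  define R where "R = (\<lambda>x\<in>D. (P ^^ exponent x) (F (index x)))"
  have R_funpow_rep: "R ((f ^^ e) (rep k)) = (P ^^ e) (F k)" if k: "k \<in> I" for k e
  proof -
    let ?x = "(f ^^ e) (rep k)"
    have x: "?x \<in> D"
      using k by (intro funpow_in rep_in)
    have "k = index ?x" and "e mod card (orbit f (rep k)) = exponent ?x mod card (orbit f (rep k))"
      using funpow_rep_eqD[OF k coordinates(1)[OF x] coordinates(2)[OF x]] .
    moreover from this(2) have "e mod card (orbit P (F k)) = exponent ?x mod card (orbit P (F k))"
      using dvd[OF k] by (metis mod_mod_cancel)
    ultimately show ?thesis
      using x by (simp add: R_def funpow_eq_funpow_iff[OF P(2)])
  qed
  have R_step: "R x \<in> Z \<and> R (f x) = P (R x)" if x: "x \<in> D" for x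
  proof -
    obtain k e where k: "k \<in> I" "x = (f ^^ e) (rep k)"
      using funpow_rep[OF x] .
    show ?thesis
      using R_funpow_rep[OF k(1), of e] R_funpow_rep[OF k(1), of "Suc e"] k
        permutes_in_image[OF permutes_funpow[OF P(1)]] PiE_mem[OF F k(1)] by simp
  qed
  have "R \<in> extensional D"
    by (simp add: R_def)
  then have "R \<in> equivariant_maps D f Z P"
    using R_step by (simp add: equivariant_maps_def PiE_iff)
  moreover have "R (rep k) = F k" if "k \<in> I" for k
    using R_funpow_rep[OF that, of 0] by simp
  ultimately show ?thesis
    by (rule that)
qed

lemma card_orbit_equivariant_dvd:
  assumes P: "permutation P" and R: "R \<in> equivariant_maps D f Z P" and k: "k \<in> I"
  shows "card (orbit P (R (rep k))) dvd card (orbit f (rep k))"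
proof -
  have "(P ^^ card (orbit f (rep k))) (R (rep k)) = R (rep k)"
    using equivariant_funpow[OF R rep_in[OF k]] funpow_card_orbit[OF permutation] by metis
  then show ?thesis
    by (simp only: funpow_eq_self_iff[OF P])
qed

theorem bij_betw_equivariant_maps:
  assumes P: "P permutes Z" "permutation P"
  shows "bij_betw (\<lambda>R. \<lambda>k\<in>I. R (rep k)) (equivariant_maps D f Z P)
    {F \<in> I \<rightarrow>\<^sub>E Z. \<forall>k\<in>I. card (orbit P (F k)) dvd card (orbit f (rep k))}"
  unfolding bij_betw_def
proof (intro conjI equalityI subsetI)
  show "inj_on (\<lambda>R. \<lambda>k\<in>I. R (rep k)) (equivariant_maps D f Z P)"
    by (intro inj_onI equivariant_eqI) (assumption | metis restrict_apply')+
next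
  fix F assume "F \<in> (\<lambda>R. \<lambda>k\<in>I. R (rep k)) ` equivariant_maps D f Z P"
  then obtain R where R: "R \<in> equivariant_maps D f Z P" and F: "F = (\<lambda>k\<in>I. R (rep k))"
    by blast
  have "R x \<in> Z" if "x \<in> D" for x
    using R that by (auto simp: equivariant_maps_def)
  then show "F \<in> {F \<in> I \<rightarrow>\<^sub>E Z. \<forall>k\<in>I. card (orbit P (F k)) dvd card (orbit f (rep k))}"
    using rep_in card_orbit_equivariant_dvd[OF P(2) R] by (auto simp: F)
next
  fix F assume "F \<in> {F \<in> I \<rightarrow>\<^sub>E Z. \<forall>k\<in>I. card (orbit P (F k)) dvd card (orbit f (rep k))}"
  then have F: "F \<in> I \<rightarrow>\<^sub>E Z" "\<And>k. k \<in> I \<Longrightarrow> card (orbit P (F k)) dvd card (orbit f (rep k))"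
    by auto
  then obtain R where R: "R \<in> equivariant_maps D f Z P" "\<And>k. k \<in> I \<Longrightarrow> R (rep k) = F k"
    using equivariant_extension[OF P] by metis
  have "F = (\<lambda>k\<in>I. R (rep k))"
    by (rule extensionalityI[of _ I]) (use F(1) R(2) in \<open>auto simp: PiE_def\<close>)
  with R(1) show "F \<in> (\<lambda>R. \<lambda>k\<in>I. R (rep k)) ` equivariant_maps D f Z P"
    by blast
qed

theorem card_equivariant_fibre:
  assumes P: "permutation P" and R: "R \<in> equivariant_maps D f Z P"
  shows "card {x \<in> D. R x = p} =
    (\<Sum>k\<in>I. if p \<in> orbit P (R (rep k))
      then card (orbit f (rep k)) div card (orbit P (R (rep k))) else 0)"
proof -
  have "{x \<in> D. R x = p} = (\<Union>k\<in>I. {x \<in> orbit f (rep k). R x = p})"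
    unfolding UN_orbit_rep[symmetric] by blast
  also have "card \<dots> = (\<Sum>k\<in>I. card {x \<in> orbit f (rep k). R x = p})"
  proof (rule card_UN_disjoint[OF finite_index])
    show "\<forall>k\<in>I. finite {x \<in> orbit f (rep k). R x = p}"
      using finite_orbit[OF permutation_self_in_orbit[OF permutation]] by simp
    show "\<forall>k\<in>I. \<forall>k'\<in>I. k \<noteq> k' \<longrightarrow>
        {x \<in> orbit f (rep k). R x = p} \<inter> {x \<in> orbit f (rep k'). R x = p} = {}"
      using index_unique by blast
  qed
  also have "\<dots> = (\<Sum>k\<in>I. if p \<in> orbit P (R (rep k))
      then card (orbit f (rep k)) div card (orbit P (R (rep k))) else 0)"
    by (intro sum.cong refl card_orbit_fibre[OF permutation P] equivariant_funpow[OF R] rep_in)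
  finally show ?thesis .
qed

end

lemma cycle_type_orbits:
  obtains os where "cycle_type m \<sigma> = map card os" "distinct os" "set os = orbit \<sigma> ` {1..m}"
proof -
  obtain xs where xs: "set xs = orbit \<sigma> ` {1..m}" "distinct xs"
    using finite_distinct_list[of "orbit \<sigma> ` {1..m}"] by auto
  have "image_mset card (mset_set (orbit \<sigma> ` {1..m})) = mset (map card xs)"
    using xs by (metis mset_map mset_set_set)
  then have "cycle_type m \<sigma> = rev (sort (map card xs))"
    unfolding cycle_type_def by (simp only: sorted_list_of_multiset_mset)
  also have "sort (map card xs) = map card (sort_key card xs)"
    by (rule properties_for_sort) simp_all
  finally have "cycle_type m \<sigma> = map card (rev (sort_key card xs))"
    by (simp add: rev_map)
  then show ?thesis
    by (rule that) (use xs in auto)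
qed

lemma cycle_type_representatives:
  assumes \<sigma>: "\<sigma> permutes {1..m}"
  obtains rep where "orbit_representatives \<sigma> {1..m} {1..length (cycle_type m \<sigma>)} rep"
    and "\<And>k. k \<in> {1..length (cycle_type m \<sigma>)} \<Longrightarrow> part (cycle_type m \<sigma>) k = card (orbit \<sigma> (rep k))"
proof -
  let ?I = "{1..length (cycle_type m \<sigma>)}"
  obtain os where os: "cycle_type m \<sigma> = map card os" "distinct os" "set os = orbit \<sigma> ` {1..m}"
    by (rule cycle_type_orbits)
  have "\<exists>rep. \<forall>k\<in>?I. rep k \<in> {1..m} \<and> orbit \<sigma> (rep k) = os ! (k - 1)"
  proof (rule bchoice, rule ballI)
    fix k assume "k \<in> ?I"
    then have "os ! (k - 1) \<in> set os"
      by (intro nth_mem) (auto simp: os(1))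
    then show "\<exists>x. x \<in> {1..m} \<and> orbit \<sigma> x = os ! (k - 1)"
      unfolding os(3) by (metis imageE)
  qed
  then obtain rep where rep: "\<And>k. k \<in> ?I \<Longrightarrow> rep k \<in> {1..m} \<and> orbit \<sigma> (rep k) = os ! (k - 1)"
    by blast
  have "bij_betw (\<lambda>k. k - 1) ?I {..<length os}"
    by (rule bij_betwI[where g = Suc]) (auto simp: os(1))
  from bij_betw_trans[OF this bij_betw_nth[OF os(2) refl os(3)[symmetric]]]
  have "bij_betw (\<lambda>k. orbit \<sigma> (rep k)) ?I (orbit \<sigma> ` {1..m})"
    by (rule bij_betw_cong[THEN iffD1, rotated]) (simp add: rep)
  with \<sigma> rep have "orbit_representatives \<sigma> {1..m} ?I rep"
    by unfold_locales auto
  moreover have "part (cycle_type m \<sigma>) k = card (orbit \<sigma> (rep k))" if k: "k \<in> ?I" for k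
    using k rep[OF k] by (auto simp: part_def os(1))
  ultimately show ?thesis
    by (rule that)
qed

section \<open>Rotation of rows\<close>

text \<open>Rows are numbered from 1. For \<open>g = gcd l j\<close>, the rows reachable from row \<open>i\<close> by repeated
  cyclic shifts by \<open>j\<close> within its group of \<open>l\<close> consecutive rows are those congruent to \<open>i\<close> modulo
  \<open>g\<close>; \<open>class_base\<close> is the first of them and \<open>class_offset\<close> the position of \<open>i\<close> among them, counted
  from 0.\<close>

definition row_group :: "nat \<Rightarrow> nat \<Rightarrow> nat" where
  "row_group l i = (i - 1) div l"

definition cyclic_shift :: "nat \<Rightarrow> int \<Rightarrow> nat \<Rightarrow> nat" where
  "cyclic_shift l k i = l * row_group l i + nat ((int (i - 1) + k) mod int l) + 1"

definition class_base :: "nat \<Rightarrow> nat \<Rightarrow> nat \<Rightarrow> nat" where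
  "class_base l g i = l * row_group l i + (i - 1) mod g + 1"

definition class_offset :: "nat \<Rightarrow> nat \<Rightarrow> nat \<Rightarrow> nat" where
  "class_offset l g i = ((i - 1) mod l) div g"

lemma cyclic_shift_pos [simp]: "0 < cyclic_shift l k i"
  by (simp add: cyclic_shift_def)

lemma class_base_pos [simp]: "0 < class_base l g i"
  by (simp add: class_base_def)

lemma row_group_cyclic_shift:
  assumes "l > 0"
  shows "row_group l (cyclic_shift l k i) = row_group l i"
proof -
  have "nat ((int (i - 1) + k) mod int l) < l"
    using assms by (simp add: nat_less_iff)
  then show ?thesis
    by (simp add: row_group_def cyclic_shift_def)
qed

lemma cyclic_shift_mod:
  assumes "l > 0"
  shows "int (cyclic_shift l k i - 1) mod int l = (int (i - 1) + k) mod int l"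
  using assms by (simp add: cyclic_shift_def)

lemma eq_iff_row_group_mod:
  assumes "0 < i" "0 < i'"
  shows "i = i' \<longleftrightarrow> row_group l i = row_group l i' \<and> (i - 1) mod l = (i' - 1) mod l"
proof -
  have "i = i' \<longleftrightarrow> i - 1 = i' - 1"
    using assms by linarith
  then show ?thesis
    unfolding row_group_def by (metis div_mult_mod_eq)
qed

lemma mod_pred_eq_iff_dvd:
  fixes m :: nat
  assumes "0 < i" "0 < i'"
  shows "(i - 1) mod m = (i' - 1) mod m \<longleftrightarrow> int m dvd int i - int i'"
proof -
  have "(i - 1) mod m = (i' - 1) mod m \<longleftrightarrow> int (i - 1) mod int m = int (i' - 1) mod int m"
    by (metis of_nat_eq_iff zmod_int)
  also have "\<dots> \<longleftrightarrow> int m dvd int i - int i'"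
    using assms by (simp add: mod_eq_dvd_iff of_nat_diff)
  finally show ?thesis .
qed

lemma cyclic_shift_eq_iff:
  assumes "l > 0" "0 < i" "0 < i'"
  shows "cyclic_shift l k i = i' \<longleftrightarrow>
    row_group l i = row_group l i' \<and> int l dvd int i + k - int i'"
proof -
  have "cyclic_shift l k i = i' \<longleftrightarrow>
      row_group l i = row_group l i' \<and> int l dvd int (cyclic_shift l k i) - int i'"
    using assms eq_iff_row_group_mod[of "cyclic_shift l k i" i' l]
    by (simp add: row_group_cyclic_shift mod_pred_eq_iff_dvd del: One_nat_def)
  also have "int l dvd int (cyclic_shift l k i) - int i' \<longleftrightarrow>
      (int (i - 1) + k) mod int l = int (i' - 1) mod int l"
    unfolding cyclic_shift_mod[OF assms(1), symmetric] mod_eq_dvd_iff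
    using assms(3) by (simp add: of_nat_diff Suc_leI)
  also have "\<dots> \<longleftrightarrow> int l dvd int i + k - int i'"
    using assms by (simp add: mod_eq_dvd_iff of_nat_diff algebra_simps)
  finally show ?thesis .
qed

lemma cyclic_shift_0: "\<lbrakk>l > 0; 0 < i\<rbrakk> \<Longrightarrow> cyclic_shift l 0 i = i"
  by (simp add: cyclic_shift_eq_iff)

lemma cyclic_shift_add:
  assumes "l > 0"
  shows "cyclic_shift l k (cyclic_shift l k' i) = cyclic_shift l (k + k') i"
proof -
  have "(int (cyclic_shift l k' i - 1) + k) mod int l = (int (i - 1) + (k + k')) mod int l"
    using cyclic_shift_mod[OF assms, of k' i] by (metis add.assoc add.commute mod_add_cong)
  then show ?thesis
    unfolding cyclic_shift_def[of l k] cyclic_shift_def[of l "k + k'"]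
      row_group_cyclic_shift[OF assms] by simp
qed

lemma class_base_offset:
  assumes "g dvd l" "0 < i"
  shows "class_base l g i + g * class_offset l g i = i"
proof -
  have "(i - 1) mod g + g * class_offset l g i = (i - 1) mod l"
    unfolding class_offset_def mod_mod_cancel[OF assms(1), symmetric, of "i - 1"] by simp
  then have "class_base l g i + g * class_offset l g i = l * ((i - 1) div l) + (i - 1) mod l + 1"
    unfolding class_base_def row_group_def by linarith
  then show ?thesis
    using assms(2) by simp
qed

lemma class_offset_less:
  assumes "l = g * \<gamma>" "l > 0"
  shows "class_offset l g i < \<gamma>"
  unfolding class_offset_def using assms by (intro less_mult_imp_div_less) (simp add: mult.commute)

lemma
  assumes "l = g * \<gamma>" "l > 0" "s < \<gamma>"
  shows class_base_row: "class_base l g (class_base l g i + g * s) = class_base l g i"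
    and class_offset_row: "class_offset l g (class_base l g i + g * s) = s"
    and row_group_row: "row_group l (class_base l g i + g * s) = row_group l i"
proof -
  define r where "r = (i - 1) mod g"
  have r_less: "r < g"
    unfolding r_def using assms by (intro mod_less_divisor) (cases g, auto)
  have "r + g * s < g * Suc s"
    using r_less by simp
  also have "\<dots> \<le> l"
    unfolding assms(1) using assms(3) by (intro mult_le_mono2) simp
  finally have less: "r + g * s < l" .
  have pred: "class_base l g i + g * s - 1 = l * row_group l i + (r + g * s)"
    by (simp add: class_base_def r_def)
  show group: "row_group l (class_base l g i + g * s) = row_group l i"
    unfolding row_group_def[of l "class_base l g i + g * s"] pred using less by simp
  have "(class_base l g i + g * s - 1) mod g = (r + g * (\<gamma> * row_group l i + s)) mod g"
    unfolding pred by (simp add: assms(1) algebra_simps)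
  then have "(class_base l g i + g * s - 1) mod g = r"
    using r_less by simp
  with group show "class_base l g (class_base l g i + g * s) = class_base l g i"
    by (simp add: class_base_def r_def)
  show "class_offset l g (class_base l g i + g * s) = s"
    unfolding class_offset_def pred using less r_less by simp
qed

lemma class_base_eq_iff:
  assumes "g dvd l" "l > 0" "0 < i" "0 < i'"
  shows "class_base l g i = class_base l g i' \<longleftrightarrow>
    row_group l i = row_group l i' \<and> int g dvd int i - int i'"
proof -
  obtain \<gamma> where \<gamma>: "l = g * \<gamma>"
    using assms(1) ..
  then have "0 < \<gamma>"
    using assms(2) by (cases \<gamma>) auto
  then have "row_group l (class_base l g k) = row_group l k" for k
    using row_group_row[OF \<gamma> assms(2), of 0 k] by simp
  then have "class_base l g i = class_base l g i' \<longleftrightarrow>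
      row_group l i = row_group l i' \<and> (i - 1) mod g = (i' - 1) mod g"
    by (metis add_left_cancel add_right_cancel class_base_def)
  then show ?thesis
    using mod_pred_eq_iff_dvd[OF assms(3,4)] by simp
qed

lemma dvd_mult_iff_div_gcd_dvd:
  fixes l :: nat and j d :: int
  assumes "l > 0"
  shows "int l dvd j * d \<longleftrightarrow> int (l div gcd l (nat \<bar>j\<bar>)) dvd d"
proof -
  let ?g = "gcd l (nat \<bar>j\<bar>)"
  have "int l = int ?g * int (l div ?g)"
    by (metis dvd_mult_div_cancel gcd_dvd1 of_nat_mult)
  moreover have "gcd (int l * d) (j * d) = int ?g * \<bar>d\<bar>"
    by (simp add: gcd_mult_right abs_mult gcd.commute)
  moreover have "int l dvd j * d \<longleftrightarrow> int l dvd gcd (int l * d) (j * d)"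
    by simp
  ultimately have "int l dvd j * d \<longleftrightarrow> int ?g * int (l div ?g) dvd int ?g * \<bar>d\<bar>"
    by metis
  then show ?thesis
    using assms by simp
qed

lemma ex_nat_dvd_diff_mult_iff:
  fixes l :: nat and j d :: int
  assumes "l > 0"
  shows "(\<exists>e::nat. int l dvd d - j * int e) \<longleftrightarrow> gcd (int l) j dvd d"
proof
  assume "\<exists>e::nat. int l dvd d - j * int e"
  then obtain e :: nat where "gcd (int l) j dvd d - j * int e"
    by (meson dvd_trans gcd_dvd1)
  then have "gcd (int l) j dvd (d - j * int e) + j * int e"
    by (intro dvd_add) auto
  then show "gcd (int l) j dvd d"
    by simp
next
  assume "gcd (int l) j dvd d"
  then obtain x where solution: "[j * x = d] (mod int l)"
    using cong_solve_dvd_int[of j "int l" d] by (auto simp: gcd.commute)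
  have "int (nat (x mod int l)) = x mod int l"
    using assms by simp
  then have "[d = j * int (nat (x mod int l))] (mod int l)"
    using solution by (simp add: cong_def mod_mult_right_eq)
  then show "\<exists>e::nat. int l dvd d - j * int e"
    unfolding cong_iff_dvd_diff by blast
qed

lemma ex_cyclic_shift_eq_iff:
  fixes j :: int
  assumes "l > 0" "0 < i" "0 < i'" and g_eq: "g = gcd l (nat \<bar>j\<bar>)"
  shows "(\<exists>e::nat. cyclic_shift l (- j * int e) i = i') \<longleftrightarrow> class_base l g i = class_base l g i'"
proof -
  have "cyclic_shift l (- j * int e) i = i' \<longleftrightarrow>
      row_group l i = row_group l i' \<and> int l dvd int i - int i' - j * int e" for e :: nat
    using cyclic_shift_eq_iff[OF assms(1-3), of "- j * int e"] by (simp add: algebra_simps)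
  then have "(\<exists>e::nat. cyclic_shift l (- j * int e) i = i') \<longleftrightarrow>
      row_group l i = row_group l i' \<and> int g dvd int i - int i'"
    using ex_nat_dvd_diff_mult_iff[OF assms(1), of "int i - int i'" j] by (simp add: g_eq)
  moreover have "g dvd l"
    unfolding g_eq by (rule gcd_dvd1)
  ultimately show ?thesis
    using class_base_eq_iff[OF _ assms(1-3)] by blast
qed

section \<open>Weakly increasing words\<close>

definition sorted_word :: "(nat \<Rightarrow> nat) \<Rightarrow> nat \<Rightarrow> nat" where
  "sorted_word c x = (LEAST k. x \<le> (\<Sum>k'\<in>{1..k}. c k'))"

lemma le_sum_sorted_word:
  assumes "x \<le> (\<Sum>k\<in>{1..N}. c k)"
  shows "x \<le> (\<Sum>k\<in>{1..sorted_word c x}. c k)"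
  unfolding sorted_word_def using assms by (rule LeastI)

lemma sorted_word_le_iff:
  assumes "x \<le> (\<Sum>k\<in>{1..N}. c k)"
  shows "sorted_word c x \<le> n \<longleftrightarrow> x \<le> (\<Sum>k\<in>{1..n}. c k)"
proof
  assume "sorted_word c x \<le> n"
  then have "(\<Sum>k\<in>{1..sorted_word c x}. c k) \<le> (\<Sum>k\<in>{1..n}. c k)"
    by (intro sum_mono2) auto
  with le_sum_sorted_word[OF assms] show "x \<le> (\<Sum>k\<in>{1..n}. c k)"
    by simp
qed (simp add: sorted_word_def Least_le)

lemma sorted_word_pos:
  assumes "0 < x" "x \<le> (\<Sum>k\<in>{1..N}. c k)"
  shows "0 < sorted_word c x"
  using sorted_word_le_iff[OF assms(2), of 0] assms(1) by simp

lemma sorted_word_eq_iff: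
  assumes "x \<le> (\<Sum>k\<in>{1..N}. c k)" "0 < k"
  shows "sorted_word c x = k \<longleftrightarrow> (\<Sum>k'\<in>{1..<k}. c k') < x \<and> x \<le> (\<Sum>k'\<in>{1..<k}. c k') + c k"
proof -
  have "{1..k - 1} = {1..<k}" and "(\<Sum>k'\<in>{1..k}. c k') = (\<Sum>k'\<in>{1..<k}. c k') + c k"
    using assms(2) by (cases k; auto simp: atLeastLessThanSuc_atLeastAtMost)+
  moreover have "sorted_word c x = k \<longleftrightarrow> \<not> sorted_word c x \<le> k - 1 \<and> sorted_word c x \<le> k"
    using assms(2) by linarith
  ultimately show ?thesis
    by (simp add: sorted_word_le_iff[OF assms(1)] not_le del: One_nat_def)
qed

lemma sorted_word_mono:
  assumes "x \<le> y" "y \<le> (\<Sum>k\<in>{1..N}. c k)"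
  shows "sorted_word c x \<le> sorted_word c y"
  using sorted_word_le_iff[of x c N] le_sum_sorted_word[OF assms(2)] assms by (metis order_trans)

lemma le_card_iff_of_mono_on:
  fixes y :: "nat \<Rightarrow> nat"
  assumes mono: "mono_on {1..N} y" and x: "x \<in> {1..N}"
  shows "x \<le> card {a \<in> {1..N}. y a \<le> k} \<longleftrightarrow> y x \<le> k"
proof
  assume "y x \<le> k"
  then have "{1..x} \<subseteq> {a \<in> {1..N}. y a \<le> k}"
    using monotone_onD[OF mono _ x] x order_trans by fastforce
  then have "card {1..x} \<le> card {a \<in> {1..N}. y a \<le> k}"
    by (intro card_mono) auto
  then show "x \<le> card {a \<in> {1..N}. y a \<le> k}"
    by simp
next
  assume x_le_card: "x \<le> card {a \<in> {1..N}. y a \<le> k}"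
  show "y x \<le> k"
  proof (rule ccontr)
    assume "\<not> y x \<le> k"
    then have "{a \<in> {1..N}. y a \<le> k} \<subseteq> {1..<x}"
      using monotone_onD[OF mono x] by (force simp: not_le[symmetric])
    then have "card {a \<in> {1..N}. y a \<le> k} \<le> card {1..<x}"
      by (intro card_mono) auto
    with x_le_card x show False
      by auto
  qed
qed

lemma sorted_word_of_mono_on:
  fixes y :: "nat \<Rightarrow> nat"
  assumes mono: "mono_on {1..N} y" and pos: "\<And>a. a \<in> {1..N} \<Longrightarrow> 0 < y a" and x: "x \<in> {1..N}"
  shows "sorted_word (\<lambda>k. card {a \<in> {1..N}. y a = k}) x = y x"
proof -
  have "(\<Sum>k'\<in>{1..k}. card {a \<in> {1..N}. y a = k'}) = card {a \<in> {1..N}. y a \<le> k}" for k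
  proof -
    have "(\<Sum>k'\<in>{1..k}. card {a \<in> {1..N}. y a = k'}) = card (\<Union>k'\<in>{1..k}. {a \<in> {1..N}. y a = k'})"
      by (subst card_UN_disjoint) auto
    also have "(\<Union>k'\<in>{1..k}. {a \<in> {1..N}. y a = k'}) = {a \<in> {1..N}. y a \<le> k}"
      using pos by (fastforce simp: Suc_le_eq)
    finally show ?thesis .
  qed
  then have "sorted_word (\<lambda>k. card {a \<in> {1..N}. y a = k}) x = (LEAST k. y x \<le> k)"
    unfolding sorted_word_def by (simp only: le_card_iff_of_mono_on[OF mono x])
  also have "\<dots> = y x"
    by (rule Least_equality) auto
  finally show ?thesis .
qed

section \<open>Partitions\<close>

definition diagram :: "nat list \<Rightarrow> (nat \<times> nat) set" where
  "diagram \<mu> = {(i, j). 0 < i \<and> 0 < j \<and> j \<le> part \<mu> i}"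

definition conjugate_part :: "nat list \<Rightarrow> nat \<Rightarrow> nat" where
  "conjugate_part \<mu> v = length (filter (\<lambda>x. v \<le> x) \<mu>)"

lemma part_Cons: "0 < i \<Longrightarrow> part (x # xs) i = (if i = 1 then x else part xs (i - 1))"
  by (auto simp: part_def nth_Cons')

lemma part_pos_iff:
  assumes "\<And>x. x \<in> set \<mu> \<Longrightarrow> 0 < x"
  shows "0 < part \<mu> i \<longleftrightarrow> i \<in> {1..length \<mu>}"
  using assms by (auto simp: part_def)

lemma part_cases: "part \<mu> i = 0 \<or> part \<mu> i \<in> set \<mu>"
  by (auto simp: part_def)

lemma le_part_iff:
  assumes "sorted_wrt (\<ge>) \<mu>" "0 < i" "0 < v"
  shows "v \<le> part \<mu> i \<longleftrightarrow> i \<le> conjugate_part \<mu> v"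
  using assms(1,2)
proof (induction \<mu> arbitrary: i)
  case Nil
  then show ?case
    using assms(3) by (simp add: part_def conjugate_part_def)
next
  case (Cons x xs)
  show ?case
  proof (cases "v \<le> x")
    case True
    then show ?thesis
      using Cons.IH[of "i - 1"] Cons.prems by (auto simp: part_Cons conjugate_part_def)
  next
    case False
    then have small: "\<forall>y\<in>set (x # xs). \<not> v \<le> y"
      using Cons.prems by auto
    then have "\<not> v \<le> part (x # xs) i"
      using part_cases[of "x # xs" i] assms(3) by auto
    moreover have "conjugate_part (x # xs) v = 0"
      using small by (simp add: conjugate_part_def)
    ultimately show ?thesis
      using Cons.prems by simp
  qed
qed

lemma dvd_conjugate_part:
  assumes "l_partition_of l \<mu> m"
  shows "l dvd conjugate_part \<mu> v"
proof -
  let ?xs = "filter (\<lambda>x. v \<le> x) \<mu>"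
  have count: "count_list ?xs u = count_list \<mu> u" if "v \<le> u" for u
    using that by (induction \<mu>) auto
  have "conjugate_part \<mu> v = (\<Sum>u\<in>set ?xs. count_list ?xs u)"
    by (simp only: conjugate_part_def sum_count_set[OF order_refl finite_set])
  also have "\<dots> = (\<Sum>u\<in>set ?xs. count_list \<mu> u)"
    by (intro sum.cong refl count) simp
  finally show ?thesis
    using assms by (simp add: l_partition_of_def dvd_sum)
qed

lemma part_eq_if_row_group_eq:
  assumes \<mu>: "l_partition_of l \<mu> m" and l_pos: "l > 0"
    and same_group: "0 < i" "0 < i'" "row_group l i = row_group l i'"
  shows "part \<mu> i = part \<mu> i'"
proof -
  have sorted: "sorted_wrt (\<ge>) \<mu>"
    using \<mu> by (simp add: l_partition_of_def partition_of_def)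
  have "v \<le> part \<mu> i \<longleftrightarrow> v \<le> part \<mu> i'" for v
  proof (cases "v = 0")
    case False
    obtain c where multiple: "conjugate_part \<mu> v = c * l"
      using dvd_conjugate_part[OF \<mu>, of v] by (metis dvdE mult.commute)
    have "k \<le> c * l \<longleftrightarrow> row_group l k < c" if "0 < k" for k
      using that l_pos by (auto simp: row_group_def div_less_iff_less_mult)
    then show ?thesis
      using False same_group le_part_iff[OF sorted] by (simp add: multiple)
  qed simp
  then show ?thesis
    by (meson order_antisym order_refl)
qed

lemma sum_part: "(\<Sum>r\<in>{1..length \<mu>}. part \<mu> r) = sum_list \<mu>"
proof -
  have "(\<Sum>r\<in>{1..length \<mu>}. part \<mu> r) = (\<Sum>r\<in>{0..<length \<mu>}. part \<mu> (Suc r))"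
    by (rule sum.reindex_bij_witness[of _ Suc "\<lambda>r. r - 1"]) auto
  also have "\<dots> = sum_list \<mu>"
    by (simp add: part_def sum_list_sum_nth)
  finally show ?thesis .
qed

lemma bij_betw_prefix_sum:
  fixes f :: "nat \<Rightarrow> nat"
  shows "bij_betw (\<lambda>(i, j). (\<Sum>r\<in>{1..<i}. f r) + j) (SIGMA i:{1..N}. {1..f i}) {1..\<Sum>r\<in>{1..N}. f r}"
proof (induction N)
  case 0
  show ?case
    by (simp add: bij_betw_def)
next
  case (Suc N)
  let ?s = "\<Sum>r\<in>{1..N}. f r" and ?g = "\<lambda>(i, j). (\<Sum>r\<in>{1..<i}. f r) + j"
  have "bij_betw (\<lambda>(i, j). ?s + j) ({Suc N} \<times> {1..f (Suc N)}) {?s + 1..?s + f (Suc N)}"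
    by (rule bij_betwI[where g = "\<lambda>x. (Suc N, x - ?s)"]) auto
  then have "bij_betw ?g ({Suc N} \<times> {1..f (Suc N)}) {?s + 1..?s + f (Suc N)}"
    by (rule bij_betw_cong[THEN iffD1, rotated]) (auto simp: atLeastLessThanSuc_atLeastAtMost)
  from bij_betw_combine[OF Suc.IH this]
  have "bij_betw ?g ((SIGMA i:{1..N}. {1..f i}) \<union> {Suc N} \<times> {1..f (Suc N)})
      ({1..?s} \<union> {?s + 1..?s + f (Suc N)})"
    by auto
  moreover have
    "(SIGMA i:{1..N}. {1..f i}) \<union> {Suc N} \<times> {1..f (Suc N)} = (SIGMA i:{1..Suc N}. {1..f i})"
    by (auto simp: le_Suc_eq)
  moreover have "{1..?s} \<union> {?s + 1..?s + f (Suc N)} = {1..\<Sum>r\<in>{1..Suc N}. f r}"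
    by auto
  ultimately show ?case
    by simp
qed

lemma bij_betw_std_num1: "bij_betw (std_num1 \<mu>) (diagram \<mu>) {1..sum_list \<mu>}"
proof -
  have "diagram \<mu> = (SIGMA i:{1..length \<mu>}. {1..part \<mu> i})"
    by (auto simp: diagram_def part_def split: if_splits)
  then show ?thesis
    using bij_betw_prefix_sum[of "part \<mu>" "length \<mu>"] by (simp only: std_num1_def sum_part)
qed

section \<open>Disjoint cycles and powers\<close>

lemma cycle_of_list_nth:
  assumes "cycle cs" "i < length cs"
  shows "cycle_of_list cs (cs ! i) = cs ! (Suc i mod length cs)"
proof -
  have "map (cycle_of_list cs) cs = rotate1 cs"
    using cyclic_rotation[OF assms(1), of 1] by simp
  then have "cycle_of_list cs (cs ! i) = rotate1 cs ! i"
    using assms(2) by (metis nth_map)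
  then show ?thesis
    using assms(2) by (simp add: nth_rotate1)
qed

lemma foldr_comp_permutes:
  assumes "\<And>k. k \<in> set ks \<Longrightarrow> f k permutes S k"
  shows "foldr (\<circ>) (map f ks) id permutes (\<Union>k\<in>set ks. S k)"
  using assms
proof (induction ks)
  case Nil
  then show ?case
    by (simp add: permutes_id[unfolded id_def] id_def)
next
  case (Cons k ks)
  have "f k permutes (\<Union>k\<in>set (k # ks). S k)"
    by (rule permutes_subset[OF Cons.prems]) auto
  moreover have "foldr (\<circ>) (map f ks) id permutes (\<Union>k\<in>set (k # ks). S k)"
    by (rule permutes_subset[OF Cons.IH]) (use Cons.prems in auto)
  moreover have "foldr (\<circ>) (map f (k # ks)) id = f k \<circ> foldr (\<circ>) (map f ks) id"
    by simp
  ultimately show ?case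
    using permutes_compose by metis
qed

lemma foldr_comp_apply:
  assumes "distinct ks" "\<And>k. k \<in> set ks \<Longrightarrow> f k permutes S k" "disjoint_family_on S (set ks)"
    and "k \<in> set ks" "x \<in> S k"
  shows "foldr (\<circ>) (map f ks) id x = f k x"
  using assms
proof (induction ks)
  case (Cons k' ks)
  let ?F = "foldr (\<circ>) (map f ks) id"
  have F_Cons: "foldr (\<circ>) (map f (k' # ks)) id x = f k' (?F x)"
    by simp
  have disjoint: "S k' \<inter> S k'' = {}" if "k'' \<in> set ks" for k''
    using Cons.prems(1,3) that by (auto simp: disjoint_family_on_def)
  show ?case
  proof (cases "k = k'")
    case True
    then have "x \<notin> (\<Union>k\<in>set ks. S k)"
      using disjoint Cons.prems(5) by blast
    moreover have "?F permutes (\<Union>k\<in>set ks. S k)"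
      using Cons.prems(2) by (intro foldr_comp_permutes) simp
    ultimately have "?F x = x"
      by (rule permutes_not_in[rotated])
    then show ?thesis
      by (simp only: F_Cons True)
  next
    case False
    then have k: "k \<in> set ks"
      using Cons.prems(4) by simp
    then have "?F x = f k x"
      using Cons.prems by (intro Cons.IH) (auto simp: disjoint_family_on_def)
    moreover have "f k x \<in> S k"
      using k Cons.prems(2,5) by (simp add: permutes_in_image)
    then have "f k' (f k x) = f k x"
      using disjoint[OF k] Cons.prems(2) by (intro permutes_not_in[of _ "S k'"]) auto
    ultimately show ?thesis
      by (simp only: F_Cons)
  qed
qed simp

lemma distinct_concat_map:
  assumes "distinct xs" "\<And>x. x \<in> set xs \<Longrightarrow> distinct (f x)"
    and "disjoint_family_on (\<lambda>x. set (f x)) (set xs)"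
  shows "distinct (concat (map f xs))"
  using assms by (induction xs) (auto simp: disjoint_family_on_def)

lemma sym_group_int_pow_apply:
  fixes act :: "int \<Rightarrow> 'b \<Rightarrow> 'b" and k :: int
  assumes carrier: "a \<in> carrier (sym_group m)"
    and act_in: "\<And>k b. b \<in> B \<Longrightarrow> act k b \<in> B"
    and act_0: "\<And>b. b \<in> B \<Longrightarrow> act 0 b = b"
    and act_add: "\<And>k k' b. b \<in> B \<Longrightarrow> act k (act k' b) = act (k + k') b"
    and a_apply: "\<And>b. b \<in> B \<Longrightarrow> a (t b) = t (act 1 b)"
    and b: "b \<in> B"
  shows "(a [^]\<^bsub>sym_group m\<^esub> k) (t b) = t (act k b)"
proof -
  interpret group "sym_group m"
    by (rule sym_group_is_group)
  have pow_Suc: "a [^]\<^bsub>sym_group m\<^esub> (k + 1) = (a [^]\<^bsub>sym_group m\<^esub> k) \<circ> a" for k :: int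
    using carrier by (simp add: int_pow_mult sym_group_mult)
  show ?thesis
    using b
  proof (induction k arbitrary: b rule: int_induct[where k = 0])
    case base
    then show ?case
      by (simp add: sym_group_one act_0)
  next
    case (step1 k)
    then show ?case
      by (simp add: pow_Suc a_apply act_in act_add)
  next
    case (step2 k)
    have "(a [^]\<^bsub>sym_group m\<^esub> (k - 1)) (t b) = (a [^]\<^bsub>sym_group m\<^esub> (k - 1)) (a (t (act (- 1) b)))"
      using step2.prems by (simp add: a_apply act_in act_add act_0)
    also have "\<dots> = (a [^]\<^bsub>sym_group m\<^esub> k) (t (act (- 1) b))"
      using pow_Suc[of "k - 1"] by simp
    also have "\<dots> = t (act (k - 1) b)"
      using step2 by (simp add: act_in act_add)
    finally show ?case .
  qed
qed

lemma (in group) ord_int_pow: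
  fixes k :: int
  assumes x: "x \<in> carrier G" and pos: "0 < ord x"
  shows "ord (x [^] k) = ord x div gcd (ord x) (nat \<bar>k\<bar>)"
proof -
  have "(x [^] k) [^] (e::nat) = \<one> \<longleftrightarrow> ord x div gcd (ord x) (nat \<bar>k\<bar>) dvd e" for e
  proof -
    have "(x [^] k) [^] e = x [^] (k * int e)"
      using int_pow_pow[OF x, of k "int e"] by (simp add: int_pow_int mult.commute)
    then show ?thesis
      using int_pow_eq_id[OF x] dvd_mult_iff_div_gcd_dvd[OF pos, of k "int e"]
      by (simp only: int_dvd_int_iff)
  qed
  then show ?thesis
    using x by (subst ord_unique) auto
qed

section \<open>The permutations as rotations of rows\<close>

lemma bij_betw_Sigma:
  assumes "\<And>i. i \<in> I \<Longrightarrow> bij_betw (f i) (A i) (B i)"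
  shows "bij_betw (\<lambda>(i, x). (i, f i x)) (Sigma I A) (Sigma I B)"
  unfolding bij_betw_def
proof
  show "inj_on (\<lambda>(i, x). (i, f i x)) (Sigma I A)"
    using assms by (fastforce simp: inj_on_def bij_betw_def)
  show "(\<lambda>(i, x). (i, f i x)) ` Sigma I A = Sigma I B"
  proof (intro equalityI subsetI)
    fix z assume "z \<in> Sigma I B"
    then obtain i y where "z = (i, y)" "i \<in> I" "y \<in> f i ` A i"
      using assms by (auto simp: bij_betw_def)
    then show "z \<in> (\<lambda>(i, x). (i, f i x)) ` Sigma I A"
      by force
  qed (use assms in \<open>auto simp: bij_betw_def\<close>)
qed

locale l_multipartition =
  fixes n :: nat and ls :: "nat \<Rightarrow> nat" and \<mu> :: "nat \<Rightarrow> nat list"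
  assumes ls_pos: "h \<in> {1..n} \<Longrightarrow> 0 < ls h"
    and l_partition: "h \<in> {1..n} \<Longrightarrow> l_partition_of (ls h) (\<mu> h) (sum_list (\<mu> h))"
begin

abbreviation B :: "box set" where
  "B \<equiv> boxes n \<mu>"

abbreviation labels :: "nat set" where
  "labels \<equiv> {1..total_size n \<mu>}"

abbreviation std :: "box \<Rightarrow> nat" where
  "std \<equiv> std_num n \<mu>"

definition rows :: "(nat \<times> nat) set" where
  "rows = {(i, h). h \<in> {1..n} \<and> 0 < i \<and> 0 < part (\<mu> h) i}"

definition row_length :: "nat \<times> nat \<Rightarrow> nat" where
  "row_length = (\<lambda>(i, h). part (\<mu> h) i)"

definition row_of :: "box \<Rightarrow> nat \<times> nat" where
  "row_of = (\<lambda>(i, x, h). (i, h))"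

definition row_shift :: "int \<Rightarrow> nat \<times> nat \<Rightarrow> nat \<times> nat" where
  "row_shift k = restrict_id (\<lambda>(i, h). (cyclic_shift (ls h) k i, h)) rows"

definition box_shift :: "int \<Rightarrow> box \<Rightarrow> box" where
  "box_shift k = (\<lambda>(i, x, h). (fst (row_shift k (i, h)), x, snd (row_shift k (i, h))))"

lemma boxes_iff: "(i, x, h) \<in> B \<longleftrightarrow> (i, h) \<in> rows \<and> x \<in> {1..row_length (i, h)}"
  by (auto simp: boxes_def rows_def row_length_def)

lemma rowsD:
  assumes "p \<in> rows"
  shows "snd p \<in> {1..n}" "0 < fst p"
  using assms by (auto simp: rows_def)

lemma row_of_image: "row_of ` B = rows"
proof (intro equalityI subsetI)
  fix p assume "p \<in> rows"
  then have "(fst p, 1, snd p) \<in> B"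
    by (auto simp: boxes_iff rows_def row_length_def)
  then show "p \<in> row_of ` B"
    by (rule rev_image_eqI) (simp add: row_of_def)
qed (auto simp: row_of_def boxes_iff)

lemma part_pos_iff_le_length: "h \<in> {1..n} \<Longrightarrow> 0 < part (\<mu> h) i \<longleftrightarrow> i \<in> {1..length (\<mu> h)}"
  using l_partition by (intro part_pos_iff) (auto simp: l_partition_of_def partition_of_def)

lemma finite_rows: "finite rows"
proof (rule finite_subset)
  show "rows \<subseteq> (\<Union>h\<in>{1..n}. {1..length (\<mu> h)} \<times> {h})"
    using part_pos_iff_le_length by (auto simp: rows_def)
qed auto

lemma part_row_group:
  assumes "h \<in> {1..n}" "0 < i" "0 < i'" "row_group (ls h) i = row_group (ls h) i'"
  shows "part (\<mu> h) i = part (\<mu> h) i'"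
  by (rule part_eq_if_row_group_eq[OF l_partition ls_pos]) (use assms in auto)

lemma part_cyclic_shift:
  assumes "h \<in> {1..n}" "0 < i"
  shows "part (\<mu> h) (cyclic_shift (ls h) k i) = part (\<mu> h) i"
  by (rule part_row_group) (use assms in \<open>auto simp: row_group_cyclic_shift ls_pos\<close>)

lemma row_shift_apply: "(i, h) \<in> rows \<Longrightarrow> row_shift k (i, h) = (cyclic_shift (ls h) k i, h)"
  by (simp add: row_shift_def)

lemma row_shift_in_rows: "p \<in> rows \<Longrightarrow> row_shift k p \<in> rows"
  by (cases p) (auto simp: row_shift_apply, auto simp: rows_def part_cyclic_shift)

lemma row_shift_0: "row_shift 0 = id"
proof
  show "row_shift 0 p = id p" for p
    by (cases "p \<in> rows"; cases p) (auto simp: row_shift_def rows_def cyclic_shift_0 ls_pos)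
qed

lemma row_shift_add: "row_shift k (row_shift k' p) = row_shift (k + k') p"
proof (cases "p \<in> rows")
  case True
  obtain i h where p_eq: "p = (i, h)"
    by (cases p)
  with True have "(cyclic_shift (ls h) k' i, h) \<in> rows" "0 < ls h"
    using row_shift_in_rows[of p k'] by (auto simp: row_shift_apply rows_def ls_pos)
  with True show ?thesis
    by (simp add: p_eq row_shift_apply cyclic_shift_add)
qed (simp add: row_shift_def)

lemma row_shift_eq_iff: "row_shift (- k) p = q \<longleftrightarrow> p = row_shift k q"
  using row_shift_add[of k "- k" p] row_shift_add[of "- k" k q] by (auto simp: row_shift_0)

lemma row_shift_permutes: "row_shift k permutes rows"
proof (rule bij_imp_permutes)
  show "bij_betw (row_shift k) rows rows"
    by (rule bij_betwI[where g = "row_shift (- k)"])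
      (auto simp: row_shift_in_rows row_shift_add row_shift_0)
qed (simp add: row_shift_def)

lemma row_shift_permutation: "permutation (row_shift k)"
  using row_shift_permutes finite_rows permutation_permutes by blast

lemma row_shift_funpow: "row_shift k ^^ e = row_shift (k * int e)"
  by (induction e) (auto simp: row_shift_0 row_shift_add algebra_simps fun_eq_iff)

lemma row_shift_eq_self_iff:
  assumes "(i, h) \<in> rows"
  shows "row_shift k (i, h) = (i, h) \<longleftrightarrow> int (ls h) dvd k"
  using assms by (auto simp: row_shift_apply rows_def cyclic_shift_eq_iff ls_pos)

lemma row_length_row_shift: "row_length (row_shift k p) = row_length p"
proof (cases "p \<in> rows")
  case True
  then show ?thesis
    by (cases p) (auto simp: row_shift_apply row_length_def, auto simp: rows_def part_cyclic_shift)
qed (simp add: row_shift_def)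

lemma row_of_box_shift: "row_of (box_shift k b) = row_shift k (row_of b)"
  by (cases b) (simp add: row_of_def box_shift_def)

lemma box_shift_eq_self_iff: "box_shift k b = b \<longleftrightarrow> row_shift k (row_of b) = row_of b"
  by (cases b) (simp add: row_of_def box_shift_def prod_eq_iff[of "row_shift _ _"])

lemma box_shift_in_boxes:
  assumes "b \<in> B"
  shows "box_shift k b \<in> B"
proof (cases b)
  case (fields i x h)
  then show ?thesis
    using assms row_shift_in_rows[of "(i, h)" k] row_length_row_shift[of k "(i, h)"]
    by (simp add: box_shift_def boxes_iff)
qed

lemma box_shift_0: "box_shift 0 b = b"
  by (cases b) (simp add: box_shift_def row_shift_0)

lemma box_shift_add: "box_shift k (box_shift k' b) = box_shift (k + k') b"
  by (cases b) (simp add: box_shift_def row_shift_add)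

lemma bij_betw_std: "bij_betw std B labels"
proof -
  have "bij_betw (\<lambda>(i, x, h). (h, i, x)) B (SIGMA h:{1..n}. diagram (\<mu> h))"
    by (rule bij_betwI[where g = "\<lambda>(h, i, x). (i, x, h)"]) (auto simp: boxes_def diagram_def)
  from bij_betw_trans[OF bij_betw_trans[OF this bij_betw_Sigma[OF bij_betw_std_num1]]
      bij_betw_prefix_sum]
  show ?thesis
    unfolding total_size_def
    by (rule bij_betw_cong[THEN iffD1, rotated]) (auto simp: std_num_def)
qed

lemma std_inj: "b \<in> B \<Longrightarrow> b' \<in> B \<Longrightarrow> std b = std b' \<longleftrightarrow> b = b'"
  using bij_betw_imp_inj_on[OF bij_betw_std] by (rule inj_on_eq_iff)

lemma finite_boxes: "finite B"
  using bij_betw_finite[OF bij_betw_std] by simp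

definition column :: "nat \<Rightarrow> nat \<Rightarrow> nat \<Rightarrow> box list" where
  "column h q x = map (\<lambda>s. (ls h * q + s, x, h)) [1..<ls h + 1]"

definition column_indices :: "(nat \<times> nat \<times> nat) list" where
  "column_indices =
     concat (map (\<lambda>h. concat (map (\<lambda>q. map (\<lambda>x. (h, q, x)) [1..<part (\<mu> h) (ls h * q + 1) + 1])
       [0..<length (\<mu> h)])) [1..<n + 1])"

definition column_cycle :: "nat \<times> nat \<times> nat \<Rightarrow> nat \<Rightarrow> nat" where
  "column_cycle = (\<lambda>(h, q, x). cycle_of_list (map std (column h q x)))"

definition column_labels :: "nat \<times> nat \<times> nat \<Rightarrow> nat set" where
  "column_labels = (\<lambda>(h, q, x). std ` set (column h q x))"

lemma a_perm_eq_column_cycles: "a_perm n \<mu> ls = foldr (\<circ>) (map column_cycle column_indices) id"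
  by (simp add: a_perm_def column_cycles_def column_indices_def column_cycle_def column_def
      map_concat comp_def del: upt_Suc)

lemma distinct_column_indices: "distinct column_indices"
  unfolding column_indices_def
  by (intro distinct_concat_map)
    (auto simp: disjoint_family_on_def distinct_map inj_on_def simp del: upt_Suc)

lemma column_indices_iff:
  "(h, q, x) \<in> set column_indices \<longleftrightarrow>
     h \<in> {1..n} \<and> q < length (\<mu> h) \<and> x \<in> {1..part (\<mu> h) (ls h * q + 1)}"
  by (force simp: column_indices_def image_iff simp del: upt_Suc)

lemma in_column_iff:
  assumes "h \<in> {1..n}"
  shows "(i, x, h') \<in> set (column h q y) \<longleftrightarrow>
    h' = h \<and> x = y \<and> 0 < i \<and> row_group (ls h) i = q"
proof -
  have "i \<in> (\<lambda>s. ls h * q + s) ` {1..ls h} \<longleftrightarrow> 0 < i \<and> row_group (ls h) i = q"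
  proof
    assume "i \<in> (\<lambda>s. ls h * q + s) ` {1..ls h}"
    then show "0 < i \<and> row_group (ls h) i = q"
      by (auto simp: row_group_def intro!: div_nat_eqI)
  next
    assume "0 < i \<and> row_group (ls h) i = q"
    then have "i = ls h * q + ((i - 1) mod ls h + 1)"
      using mult_div_mod_eq[of "ls h" "i - 1"] by (simp add: row_group_def)
    moreover have "(i - 1) mod ls h + 1 \<in> {1..ls h}"
      using ls_pos[OF assms] by (simp add: Suc_le_eq)
    ultimately show "i \<in> (\<lambda>s. ls h * q + s) ` {1..ls h}"
      by (rule image_eqI)
  qed
  moreover have "set (column h q y) = (\<lambda>i. (i, y, h)) ` (\<lambda>s. ls h * q + s) ` {1..ls h}"
    unfolding image_image by (simp add: column_def atLeastLessThanSuc_atLeastAtMost del: upt_Suc)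
  ultimately show ?thesis
    by (simp add: image_iff conj_ac)
qed

lemma column_subset_boxes:
  assumes "(h, q, x) \<in> set column_indices"
  shows "set (column h q x) \<subseteq> B"
proof clarify
  fix i y h' assume "(i, y, h') \<in> set (column h q x)"
  then have coordinates: "y = x" "h' = h" "0 < i" "row_group (ls h) i = q"
    using assms by (auto simp: column_indices_iff in_column_iff)
  have "part (\<mu> h) i = part (\<mu> h) (ls h * q + 1)"
    by (rule part_row_group)
      (use assms coordinates in \<open>auto simp: column_indices_iff row_group_def ls_pos\<close>)
  then show "(i, y, h') \<in> B"
    using assms coordinates by (auto simp: column_indices_iff boxes_def)
qed

lemma box_in_column:
  assumes "(i, x, h) \<in> B"
  shows "(h, row_group (ls h) i, x) \<in> set column_indices"
    and "(i, x, h) \<in> set (column h (row_group (ls h) i) x)"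
proof -
  let ?q = "row_group (ls h) i"
  have h_in: "h \<in> {1..n}" and i_pos: "0 < i" and x_in: "x \<in> {1..part (\<mu> h) i}"
    using assms by (auto simp: boxes_def)
  have part: "part (\<mu> h) i = part (\<mu> h) (ls h * ?q + 1)"
    by (rule part_row_group) (use h_in i_pos ls_pos in \<open>auto simp: row_group_def\<close>)
  have "?q < ls h * ?q + 1"
    using ls_pos[OF h_in] by (simp add: less_Suc_eq_le)
  also have "\<dots> \<le> length (\<mu> h)"
    using x_in part part_pos_iff_le_length[OF h_in, of "ls h * ?q + 1"] by auto
  finally show "(h, ?q, x) \<in> set column_indices"
    using h_in x_in part by (simp add: column_indices_iff)
  show "(i, x, h) \<in> set (column h ?q x)"
    using i_pos by (simp add: in_column_iff[OF h_in])
qed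

lemma column_cycle_permutes: "column_cycle c permutes column_labels c"
proof (cases c)
  case (fields h q x)
  then show ?thesis
    using cycle_permutes[of "map std (column h q x)"]
    by (simp add: column_cycle_def column_labels_def)
qed

lemma UN_column_labels: "(\<Union>c\<in>set column_indices. column_labels c) = labels"
proof -
  have "(\<Union>c\<in>set column_indices. column_labels c) = std ` B"
  proof (intro equalityI subsetI)
    fix z assume "z \<in> std ` B"
    then obtain i x h where box: "(i, x, h) \<in> B" "z = std (i, x, h)"
      by auto
    then have "z \<in> column_labels (h, row_group (ls h) i, x)"
      using box_in_column(2)[OF box(1)] by (simp add: column_labels_def)
    then show "z \<in> (\<Union>c\<in>set column_indices. column_labels c)"
      using box_in_column(1)[OF box(1)] by blast
  qed (use column_subset_boxes in \<open>fastforce simp: column_labels_def\<close>)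
  then show ?thesis
    using bij_betw_imp_surj_on[OF bij_betw_std] by simp
qed

lemma disjoint_column_labels: "disjoint_family_on column_labels (set column_indices)"
  unfolding disjoint_family_on_def
proof (intro ballI impI, rule ccontr)
  fix c c' assume indices: "c \<in> set column_indices" "c' \<in> set column_indices" "c \<noteq> c'"
    and "column_labels c \<inter> column_labels c' \<noteq> {}"
  obtain h q x where c_eq: "c = (h, q, x)"
    by (cases c)
  obtain h' q' x' where c'_eq: "c' = (h', q', x')"
    by (cases c')
  obtain b b' where common_label:
    "b \<in> set (column h q x)" "b' \<in> set (column h' q' x')" "std b = std b'"
    using \<open>column_labels c \<inter> column_labels c' \<noteq> {}\<close> by (auto simp: c_eq c'_eq column_labels_def)
  then have "b = b'"
    using indices(1,2) column_subset_boxes std_inj unfolding c_eq c'_eq by blast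
  moreover obtain i y g where "b = (i, y, g)"
    by (rule prod_cases3)
  ultimately show False
    using common_label(1,2) indices by (auto simp: c_eq c'_eq column_indices_iff in_column_iff)
qed

lemma a_perm_permutes: "a_perm n \<mu> ls permutes labels"
  unfolding a_perm_eq_column_cycles UN_column_labels[symmetric]
  by (intro foldr_comp_permutes column_cycle_permutes)

lemma box_shift_1_column:
  assumes "(h, q, x) \<in> set column_indices" "r < ls h"
  shows "box_shift 1 (column h q x ! r) = column h q x ! (Suc r mod ls h)"
proof -
  have "(ls h * q + r + 1, x, h) \<in> set (column h q x)"
    using assms by (auto simp: column_def image_iff simp del: upt_Suc)
  then have "(ls h * q + r + 1, h) \<in> rows"
    using column_subset_boxes[OF assms(1)] by (auto simp: boxes_iff)
  moreover have "cyclic_shift (ls h) 1 (ls h * q + r + 1) = ls h * q + Suc r mod ls h + 1"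
  proof -
    have "int (ls h * q + r) + 1 = int (ls h * q + Suc r)"
      by simp
    then have "(int (ls h * q + r) + 1) mod int (ls h) = int (Suc r mod ls h)"
      by (simp only: zmod_int[symmetric] mod_mult_self4)
    then show ?thesis
      using assms(2) by (simp add: cyclic_shift_def row_group_def)
  qed
  ultimately show ?thesis
    using assms(2) by (simp add: column_def box_shift_def row_shift_apply del: upt_Suc)
qed

lemma column_cycle_apply:
  assumes index: "(h, q, x) \<in> set column_indices" and box: "b \<in> set (column h q x)"
  shows "column_cycle (h, q, x) (std b) = std (box_shift 1 b)"
proof -
  let ?cs = "column h q x"
  have length: "length ?cs = ls h"
    by (simp add: column_def del: upt_Suc)
  have "distinct ?cs"
    by (simp add: column_def distinct_map inj_on_def del: upt_Suc)
  moreover have "inj_on std (set ?cs)"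
    using bij_betw_imp_inj_on[OF bij_betw_std] column_subset_boxes[OF index] by (rule inj_on_subset)
  ultimately have "cycle (map std ?cs)"
    by (simp add: distinct_map)
  moreover obtain r where "r < ls h" "b = ?cs ! r"
    using box by (metis in_set_conv_nth length)
  ultimately show ?thesis
    using cycle_of_list_nth[of "map std ?cs" r] index
    by (simp add: column_cycle_def length box_shift_1_column)
qed

lemma a_perm_apply:
  assumes "b \<in> B"
  shows "a_perm n \<mu> ls (std b) = std (box_shift 1 b)"
proof -
  obtain h q x where index: "(h, q, x) \<in> set column_indices" and box: "b \<in> set (column h q x)"
    using assms box_in_column by (cases b) metis
  have "a_perm n \<mu> ls (std b) = column_cycle (h, q, x) (std b)"
    unfolding a_perm_eq_column_cycles
    by (rule foldr_comp_apply[OF distinct_column_indices column_cycle_permutes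
          disjoint_column_labels index])
      (use box in \<open>simp add: column_labels_def\<close>)
  then show ?thesis
    using column_cycle_apply[OF index box] by simp
qed

lemma a_perm_carrier: "a_perm n \<mu> ls \<in> carrier (sym_group (total_size n \<mu>))"
  using a_perm_permutes by (simp add: sym_group_carrier)

lemma a_perm_int_pow_apply:
  fixes k :: int
  assumes "b \<in> B"
  shows "(a_perm n \<mu> ls [^]\<^bsub>sym_group (total_size n \<mu>)\<^esub> k) (std b) = std (box_shift k b)"
  using assms
  by (intro sym_group_int_pow_apply[where B = B and act = box_shift])
    (simp_all add: a_perm_carrier a_perm_apply box_shift_in_boxes box_shift_0 box_shift_add)

lemma a_perm_int_pow_eq_one_iff:
  fixes k :: int
  shows "a_perm n \<mu> ls [^]\<^bsub>sym_group (total_size n \<mu>)\<^esub> k = \<one>\<^bsub>sym_group (total_size n \<mu>)\<^esub> \<longleftrightarrow>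
    (\<forall>(i, h)\<in>rows. int (ls h) dvd k)"
proof -
  interpret group "sym_group (total_size n \<mu>)"
    by (rule sym_group_is_group)
  let ?p = "a_perm n \<mu> ls [^]\<^bsub>sym_group (total_size n \<mu>)\<^esub> k"
  have "?p permutes labels"
    using int_pow_closed[OF a_perm_carrier, of k] by (simp add: sym_group_carrier)
  then have "?p = id \<longleftrightarrow> (\<forall>x\<in>labels. ?p x = x)"
    by (metis eq_id_iff permutes_not_in)
  also have "\<dots> \<longleftrightarrow> (\<forall>b\<in>B. ?p (std b) = std b)"
    unfolding bij_betw_imp_surj_on[OF bij_betw_std, symmetric] by blast
  also have "\<dots> \<longleftrightarrow> (\<forall>b\<in>B. box_shift k b = b)"
    by (intro ball_cong refl) (simp add: a_perm_int_pow_apply std_inj box_shift_in_boxes)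
  also have "\<dots> \<longleftrightarrow> (\<forall>p\<in>rows. row_shift k p = p)"
    unfolding row_of_image[symmetric] by (simp add: box_shift_eq_self_iff)
  also have "\<dots> \<longleftrightarrow> (\<forall>(i, h)\<in>rows. int (ls h) dvd k)"
    by (intro ball_cong refl) (auto simp: row_shift_eq_self_iff)
  finally show ?thesis
    by (simp add: sym_group_one)
qed

end

lemma l_multipartition_single:
  assumes "l_partition_of l \<mu> m" "0 < l"
  shows "l_multipartition 1 (\<lambda>_. l) (\<lambda>_. \<mu>)"
  using assms by unfold_locales (auto simp: l_partition_of_def partition_of_def)

lemma a_perm1_eq_a_perm:
  assumes "l_partition_of l \<mu> m" "0 < l"
  shows "a_perm1 \<mu> l = a_perm 1 (\<lambda>_. \<mu>) (\<lambda>_. l)"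
proof -
  interpret l_multipartition 1 "\<lambda>_. l" "\<lambda>_. \<mu>"
    by (rule l_multipartition_single[OF assms])
  have "std_num1 \<mu> (l * q + s, x) = std (l * q + s, x, 1)"
    if "q < length \<mu>" "x \<in> {1..part \<mu> (l * q + 1)}" "s \<in> {1..l}" for q x s
  proof -
    have "(l * q + s, x, 1) \<in> set (column 1 q x)"
      using that(3) by (auto simp: column_def simp del: upt_Suc)
    then have "(l * q + s, x, 1) \<in> B"
      using column_subset_boxes[of 1 q x] that
      by (auto simp: column_indices_iff simp del: One_nat_def)
    then show ?thesis
      by (simp add: std_num_def)
  qed
  then have "column_cycles l \<mu> (std_num1 \<mu>) = column_cycles l \<mu> (\<lambda>(i, x). std (i, x, 1))"
    unfolding column_cycles_def
    by (intro arg_cong[where f = concat] map_cong refl arg_cong[where f = cycle_of_list])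
      (auto simp del: upt_Suc)
  then show ?thesis
    by (simp add: a_perm1_def a_perm_def)
qed

lemma ord_a_perm1_int_pow:
  fixes j :: int
  assumes \<mu>: "l_partition_of l \<mu> m" and l_pos: "0 < l" and m_pos: "0 < m"
  shows "group.ord (sym_group m) (a_perm1 \<mu> l [^]\<^bsub>sym_group m\<^esub> j) = l div gcd l (nat \<bar>j\<bar>)"
proof -
  interpret l_multipartition 1 "\<lambda>_. l" "\<lambda>_. \<mu>"
    by (rule l_multipartition_single[OF \<mu> l_pos])
  interpret group "sym_group m"
    by (rule sym_group_is_group)
  have size: "total_size 1 (\<lambda>_. \<mu>) = m"
    using \<mu> by (simp add: total_size_def l_partition_of_def partition_of_def)
  have "1 \<in> {1..length \<mu>}"
    using \<mu> m_pos by (cases \<mu>) (auto simp: l_partition_of_def partition_of_def)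
  then have rows: "(1, 1) \<in> rows"
    using part_pos_iff_le_length[of 1 1] by (simp add: rows_def del: One_nat_def)
  have carrier: "a_perm1 \<mu> l \<in> carrier (sym_group m)"
    using a_perm_carrier unfolding size a_perm1_eq_a_perm[OF \<mu> l_pos] .
  have "ord (a_perm1 \<mu> l) = l"
  proof (subst ord_unique[OF carrier], intro allI)
    fix e :: nat
    have "a_perm1 \<mu> l [^]\<^bsub>sym_group m\<^esub> e = \<one>\<^bsub>sym_group m\<^esub> \<longleftrightarrow> (\<forall>(i, h)\<in>rows. int l dvd int e)"
      using a_perm_int_pow_eq_one_iff[of "int e"]
      unfolding size a_perm1_eq_a_perm[OF \<mu> l_pos] int_pow_int .
    also have "\<dots> \<longleftrightarrow> l dvd e"
      using rows by auto
    finally show "a_perm1 \<mu> l [^]\<^bsub>sym_group m\<^esub> e = \<one>\<^bsub>sym_group m\<^esub> \<longleftrightarrow> l dvd e" .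
  qed
  then show ?thesis
    using ord_int_pow[OF carrier] l_pos by simp
qed

section \<open>Tabloids as row maps\<close>

lemma ex_bij_betw_of_card_fibres:
  assumes "finite A" "finite B" "f ` A \<subseteq> I" "g ` B \<subseteq> I"
    and card: "\<And>p. p \<in> I \<Longrightarrow> card {a \<in> A. f a = p} = card {b \<in> B. g b = p}"
  obtains T where "bij_betw T A B" "\<And>a. a \<in> A \<Longrightarrow> g (T a) = f a"
proof -
  have "\<exists>\<phi>. \<forall>p\<in>I. bij_betw (\<phi> p) {a \<in> A. f a = p} {b \<in> B. g b = p}"
    using assms(1,2) card by (intro bchoice ballI finite_same_card_bij) auto
  then obtain \<phi> where \<phi>_bij: "\<And>p. p \<in> I \<Longrightarrow> bij_betw (\<phi> p) {a \<in> A. f a = p} {b \<in> B. g b = p}"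
    by blast
  define T where "T a = \<phi> (f a) a" for a
  have bij_fibre: "bij_betw T {a \<in> A. f a = p} {b \<in> B. g b = p}" if "p \<in> I" for p
    using \<phi>_bij[OF that] by (rule bij_betw_cong[THEN iffD1, rotated]) (simp add: T_def)
  have "bij_betw T (\<Union>p\<in>I. {a \<in> A. f a = p}) (\<Union>p\<in>I. {b \<in> B. g b = p})"
    by (rule bij_betw_UNION_disjoint[OF _ bij_fibre]) (auto simp: disjoint_family_on_def)
  moreover have "(\<Union>p\<in>I. {a \<in> A. f a = p}) = A" "(\<Union>p\<in>I. {b \<in> B. g b = p}) = B"
    using assms(3,4) by auto
  ultimately have "bij_betw T A B"
    by simp
  moreover have "g (T a) = f a" if "a \<in> A" for a
    using bij_betwE[OF bij_fibre, of "f a"] that assms(3) by auto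
  ultimately show ?thesis
    by (rule that)
qed

lemma ex1_permutes_of_bij_betw:
  assumes bij_t: "bij_betw t A D" and bij_T: "bij_betw T A D"
  shows "\<exists>!\<tau>. \<tau> permutes D \<and> (\<forall>a\<in>A. \<tau> (t a) = T a)"
proof (rule ex_ex1I)
  let ?\<tau> = "restrict_id (T \<circ> inv_into A t) D"
  have "?\<tau> permutes D"
    by (rule permutes_restrict_id[OF bij_betw_trans[OF bij_betw_inv_into[OF bij_t] bij_T]])
  moreover have "?\<tau> (t a) = T a" if "a \<in> A" for a
    using that bij_betwE[OF bij_t] bij_betw_inv_into_left[OF bij_t] by simp
  ultimately show "\<exists>\<tau>. \<tau> permutes D \<and> (\<forall>a\<in>A. \<tau> (t a) = T a)"
    by blast
next
  fix \<tau> \<tau>' assume \<tau>: "\<tau> permutes D \<and> (\<forall>a\<in>A. \<tau> (t a) = T a)"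
    and \<tau>': "\<tau>' permutes D \<and> (\<forall>a\<in>A. \<tau>' (t a) = T a)"
  show "\<tau> = \<tau>'"
  proof
    show "\<tau> y = \<tau>' y" for y
    proof (cases "y \<in> D")
      case True
      then show ?thesis
        using \<tau> \<tau>' bij_betw_imp_surj_on[OF bij_t] by auto
    next
      case False
      then show ?thesis
        using \<tau> \<tau>' permutes_not_in[of \<tau> D y] permutes_not_in[of \<tau>' D y] by simp
    qed
  qed
qed

context l_multipartition
begin

definition rowmap :: "(box \<Rightarrow> nat) \<Rightarrow> nat \<Rightarrow> nat \<times> nat" where
  "rowmap T = (\<lambda>y\<in>labels. row_of (inv_into B T y))"

definition rowmap_tabloid :: "(nat \<Rightarrow> nat \<times> nat) \<Rightarrow> (box \<Rightarrow> nat) set" where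
  "rowmap_tabloid R = {T \<in> numberings n \<mu>. rowmap T = R}"

definition rowmaps :: "(nat \<Rightarrow> nat \<times> nat) set" where
  "rowmaps = {R \<in> labels \<rightarrow>\<^sub>E rows. \<forall>p\<in>rows. card {y \<in> labels. R y = p} = row_length p}"

lemma numberings_iff: "T \<in> numberings n \<mu> \<longleftrightarrow> T \<in> extensional B \<and> bij_betw T B labels"
  by (simp add: numberings_def)

lemma numbering_in_labels: "T \<in> numberings n \<mu> \<Longrightarrow> b \<in> B \<Longrightarrow> T b \<in> labels"
  using bij_betwE numberings_iff by blast

lemma numbering_image: "T \<in> numberings n \<mu> \<Longrightarrow> T ` B = labels"
  by (simp add: numberings_iff bij_betw_def)

lemma rowmap_apply:
  assumes "T \<in> numberings n \<mu>" "b \<in> B"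
  shows "rowmap T (T b) = row_of b"
  using assms numbering_in_labels[OF assms] bij_betw_inv_into_left[of T B labels b]
  by (simp add: rowmap_def numberings_iff)

lemma rowmap_extensional: "rowmap T \<in> extensional labels"
  by (simp add: rowmap_def)

lemma rowmap_eqI:
  assumes T: "T \<in> numberings n \<mu>" and R: "R \<in> extensional labels"
    and R_row: "\<And>b. b \<in> B \<Longrightarrow> R (T b) = row_of b"
  shows "rowmap T = R"
proof (rule extensionalityI[OF rowmap_extensional R])
  fix y assume "y \<in> labels"
  then obtain b where "b \<in> B" "y = T b"
    unfolding numbering_image[OF T, symmetric] by blast
  then show "rowmap T y = R y"
    using R_row rowmap_apply[OF T] by simp
qed

lemma bij_betw_row:
  assumes "T \<in> numberings n \<mu>"
  shows "bij_betw T (row n \<mu> i h) {y \<in> labels. rowmap T y = (i, h)}"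
proof -
  have "row n \<mu> i h = {b \<in> B. row_of b = (i, h)}"
    by (auto simp: row_def row_of_def)
  moreover have "bij_betw T {b \<in> B. row_of b = (i, h)} {y \<in> labels. rowmap T y = (i, h)}"
    by (rule bij_betw_Collect) (use assms in \<open>simp_all only: numberings_iff rowmap_apply\<close>)
  ultimately show ?thesis
    by (simp only:)
qed

lemma card_row:
  assumes "(i, h) \<in> rows"
  shows "card (row n \<mu> i h) = row_length (i, h)"
proof -
  have "row n \<mu> i h = (\<lambda>x. (i, x, h)) ` {1..row_length (i, h)}"
    using assms by (auto simp: row_def boxes_iff)
  then show ?thesis
    by (simp add: card_image inj_on_def)
qed

lemma row_equiv_iff:
  assumes "T \<in> numberings n \<mu>" "T' \<in> numberings n \<mu>"
  shows "(T, T') \<in> row_equiv n \<mu> \<longleftrightarrow> rowmap T = rowmap T'"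
proof -
  have "(T, T') \<in> row_equiv n \<mu> \<longleftrightarrow>
      (\<forall>i h. {y \<in> labels. rowmap T y = (i, h)} = {y \<in> labels. rowmap T' y = (i, h)})"
    using bij_betw_imp_surj_on[OF bij_betw_row] assms by (simp add: row_equiv_def)
  also have "\<dots> \<longleftrightarrow> (\<forall>p. {y \<in> labels. rowmap T y = p} = {y \<in> labels. rowmap T' y = p})"
    by (simp only: split_paired_All)
  also have "\<dots> \<longleftrightarrow> (\<forall>y\<in>labels. rowmap T y = rowmap T' y)"
    unfolding set_eq_iff mem_Collect_eq by metis
  also have "\<dots> \<longleftrightarrow> rowmap T = rowmap T'"
    using extensionalityI[OF rowmap_extensional rowmap_extensional] by metis
  finally show ?thesis .
qed

lemma tabloid_eq_rowmap_tabloid: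
  assumes "T \<in> numberings n \<mu>"
  shows "tabloid n \<mu> T = rowmap_tabloid (rowmap T)"
proof -
  have "T' \<in> tabloid n \<mu> T \<longleftrightarrow> T' \<in> numberings n \<mu> \<and> rowmap T' = rowmap T" for T'
  proof (cases "T' \<in> numberings n \<mu>")
    case True
    then show ?thesis
      using row_equiv_iff[OF assms True] by (auto simp: tabloid_def)
  qed (auto simp: tabloid_def row_equiv_def)
  then show ?thesis
    by (auto simp: rowmap_tabloid_def)
qed

lemma rowmap_in_rowmaps:
  assumes T: "T \<in> numberings n \<mu>"
  shows "rowmap T \<in> rowmaps"
proof -
  have "rowmap T y \<in> rows" if "y \<in> labels" for y
  proof -
    obtain b where "b \<in> B" "y = T b"
      using \<open>y \<in> labels\<close> unfolding numbering_image[OF T, symmetric] by blast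
    then show ?thesis
      using rowmap_apply[OF T] row_of_image by blast
  qed
  moreover have "card {y \<in> labels. rowmap T y = (i, h)} = row_length (i, h)"
    if "(i, h) \<in> rows" for i h
    using bij_betw_same_card[OF bij_betw_row[OF T, of i h]] card_row[OF that] by simp
  ultimately show ?thesis
    using rowmap_extensional by (auto simp: rowmaps_def PiE_iff)
qed

lemma rowmap_surj:
  assumes R: "R \<in> rowmaps"
  obtains T where "T \<in> numberings n \<mu>" "rowmap T = R"
proof -
  have card: "card {b \<in> B. row_of b = p} = card {y \<in> labels. R y = p}" if "p \<in> rows" for p
  proof -
    have "{b \<in> B. row_of b = p} = row n \<mu> (fst p) (snd p)"
      by (auto simp: row_def row_of_def)
    then show ?thesis
      using R that card_row[of "fst p" "snd p"] by (simp add: rowmaps_def)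
  qed
  have "row_of ` B \<subseteq> rows" and "R ` labels \<subseteq> rows"
    using R row_of_image by (auto simp: rowmaps_def)
  from ex_bij_betw_of_card_fibres[OF finite_boxes finite_atLeastAtMost this card]
  obtain T where T: "bij_betw T B labels" "\<And>b. b \<in> B \<Longrightarrow> R (T b) = row_of b"
    by blast
  have "bij_betw (restrict T B) B labels"
    using T(1) by simp
  then have numbering: "restrict T B \<in> numberings n \<mu>"
    by (simp add: numberings_iff)
  moreover have "rowmap (restrict T B) = R"
    by (rule rowmap_eqI[OF numbering]) (use R T(2) in \<open>auto simp: rowmaps_def PiE_def\<close>)
  ultimately show ?thesis
    by (rule that)
qed

lemma rowmap_image: "rowmap ` numberings n \<mu> = rowmaps"
  using rowmap_in_rowmaps rowmap_surj by blast

lemma inj_on_rowmap_tabloid: "inj_on rowmap_tabloid rowmaps"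
proof (rule inj_onI)
  fix R R' assume "R \<in> rowmaps" and same_tabloid: "rowmap_tabloid R = rowmap_tabloid R'"
  then obtain T where T: "T \<in> numberings n \<mu>" "rowmap T = R"
    using rowmap_surj by blast
  then have "T \<in> rowmap_tabloid R'"
    using same_tabloid by (auto simp: rowmap_tabloid_def)
  with T show "R = R'"
    by (simp add: rowmap_tabloid_def)
qed

lemma bij_betw_rowmap_tabloid: "bij_betw rowmap_tabloid rowmaps (tabloids n \<mu>)"
proof -
  have "tabloids n \<mu> = tabloid n \<mu> ` numberings n \<mu>"
    by (auto simp: tabloids_def quotient_def tabloid_def)
  also have "\<dots> = rowmap_tabloid ` rowmap ` numberings n \<mu>"
    unfolding image_image by (rule image_cong[OF refl tabloid_eq_rowmap_tabloid])
  finally show ?thesis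
    using inj_on_rowmap_tabloid by (simp add: bij_betw_def rowmap_image)
qed

lemma
  assumes \<sigma>: "\<sigma> permutes labels" and T: "T \<in> numberings n \<mu>"
  shows left_num_in_numberings: "left_num n \<mu> \<sigma> T \<in> numberings n \<mu>"
    and rowmap_left_num: "rowmap (left_num n \<mu> \<sigma> T) = (\<lambda>y\<in>labels. rowmap T (inv' \<sigma> y))"
proof -
  have left_num: "left_num n \<mu> \<sigma> T b = \<sigma> (T b)" if "b \<in> B" for b
    using that by (simp add: left_num_def compose_def)
  have "bij_betw (\<sigma> \<circ> T) B labels"
    using T permutes_imp_bij[OF \<sigma>] by (auto simp: numberings_iff intro: bij_betw_trans)
  then have "bij_betw (left_num n \<mu> \<sigma> T) B labels"
    by (rule bij_betw_cong[THEN iffD1, rotated]) (simp add: left_num)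
  then show numbering: "left_num n \<mu> \<sigma> T \<in> numberings n \<mu>"
    by (simp add: numberings_iff left_num_def compose_def)
  show "rowmap (left_num n \<mu> \<sigma> T) = (\<lambda>y\<in>labels. rowmap T (inv' \<sigma> y))"
  proof (rule rowmap_eqI[OF numbering])
    fix b assume b: "b \<in> B"
    then show "(\<lambda>y\<in>labels. rowmap T (inv' \<sigma> y)) (left_num n \<mu> \<sigma> T b) = row_of b"
      using numbering_in_labels[OF numbering b]
      by (simp add: left_num rowmap_apply[OF T] permutes_inverses(2)[OF \<sigma>])
  qed simp
qed

lemma tau_apply:
  assumes T: "T \<in> numberings n \<mu>" and b: "b \<in> B"
  shows "tau n \<mu> T (std b) = T b"
proof -
  have "T = compose B \<tau> std \<longleftrightarrow> (\<forall>b\<in>B. \<tau> (std b) = T b)" for \<tau>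
  proof
    assume "\<forall>b\<in>B. \<tau> (std b) = T b"
    then show "T = compose B \<tau> std"
      using T by (intro extensionalityI[of T B]) (auto simp: numberings_iff compose_def)
  next
    assume "T = compose B \<tau> std"
    then show "\<forall>b\<in>B. \<tau> (std b) = T b"
      by (metis compose_eq)
  qed
  moreover have "\<exists>!\<tau>. \<tau> permutes labels \<and> (\<forall>b\<in>B. \<tau> (std b) = T b)"
    using T by (intro ex1_permutes_of_bij_betw bij_betw_std) (simp add: numberings_iff)
  ultimately have "\<forall>b\<in>B. tau n \<mu> T (std b) = T b"
    unfolding tau_def by (simp only:) (drule theI', blast)
  with b show ?thesis
    by blast
qed

lemma
  fixes k :: int
  assumes T: "T \<in> numberings n \<mu>"
  defines "T' \<equiv> right_num n \<mu> T (a_perm n \<mu> ls [^]\<^bsub>sym_group (total_size n \<mu>)\<^esub> k)"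
  shows right_num_in_numberings: "T' \<in> numberings n \<mu>"
    and rowmap_right_num: "rowmap T' = (\<lambda>y\<in>labels. row_shift (- k) (rowmap T y))"
proof -
  have T'_apply: "T' b = T (box_shift k b)" if "b \<in> B" for b
    unfolding T'_def right_num_def compose_def
    using that by (simp add: a_perm_int_pow_apply tau_apply[OF T] box_shift_in_boxes)
  have "bij_betw (box_shift k) B B"
    by (rule bij_betwI[where g = "box_shift (- k)"])
      (auto simp: box_shift_in_boxes box_shift_add box_shift_0)
  then have "bij_betw (T \<circ> box_shift k) B labels"
    using T by (auto simp: numberings_iff intro: bij_betw_trans)
  then have "bij_betw T' B labels"
    by (rule bij_betw_cong[THEN iffD1, rotated]) (simp add: T'_apply)
  then show numbering: "T' \<in> numberings n \<mu>"
    by (simp add: numberings_iff T'_def right_num_def compose_def)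
  show "rowmap T' = (\<lambda>y\<in>labels. row_shift (- k) (rowmap T y))"
  proof (rule rowmap_eqI[OF numbering])
    fix b assume b: "b \<in> B"
    have "row_shift (- k) (rowmap T (T' b)) = row_of b"
      using rowmap_apply[OF T box_shift_in_boxes[OF b, of k]]
      by (simp add: T'_apply[OF b] row_of_box_shift row_shift_add row_shift_0)
    then show "(\<lambda>y\<in>labels. row_shift (- k) (rowmap T y)) (T' b) = row_of b"
      using numbering_in_labels[OF numbering b] by simp
  qed simp
qed

lemma
  assumes \<sigma>: "\<sigma> permutes labels" and R: "R \<in> rowmaps"
  shows permuted_rowmap_in_rowmaps: "(\<lambda>y\<in>labels. R (inv' \<sigma> y)) \<in> rowmaps"
    and left_tabloid_rowmap_tabloid:
      "left_tabloid n \<mu> \<sigma> (rowmap_tabloid R) = rowmap_tabloid (\<lambda>y\<in>labels. R (inv' \<sigma> y))"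
proof -
  obtain T where T: "T \<in> numberings n \<mu>" "rowmap T = R"
    using rowmap_surj[OF R] .
  then show "(\<lambda>y\<in>labels. R (inv' \<sigma> y)) \<in> rowmaps"
    using rowmap_in_rowmaps[OF left_num_in_numberings[OF \<sigma> T(1)]]
    by (simp add: rowmap_left_num[OF \<sigma>])
  show "left_tabloid n \<mu> \<sigma> (rowmap_tabloid R) = rowmap_tabloid (\<lambda>y\<in>labels. R (inv' \<sigma> y))"
    unfolding left_tabloid_def using T
    by (auto simp: rowmap_tabloid_def tabloid_eq_rowmap_tabloid left_num_in_numberings[OF \<sigma>]
        rowmap_left_num[OF \<sigma>])
qed

lemma
  fixes k :: int
  assumes R: "R \<in> rowmaps"
  shows shifted_rowmap_in_rowmaps: "(\<lambda>y\<in>labels. row_shift (- k) (R y)) \<in> rowmaps"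
    and right_tabloid_rowmap_tabloid:
      "right_tabloid n \<mu> (rowmap_tabloid R) (a_perm n \<mu> ls [^]\<^bsub>sym_group (total_size n \<mu>)\<^esub> k) =
        rowmap_tabloid (\<lambda>y\<in>labels. row_shift (- k) (R y))"
proof -
  obtain T where T: "T \<in> numberings n \<mu>" "rowmap T = R"
    using rowmap_surj[OF R] .
  then show "(\<lambda>y\<in>labels. row_shift (- k) (R y)) \<in> rowmaps"
    using rowmap_in_rowmaps[OF right_num_in_numberings[OF T(1), of k]]
    by (simp add: rowmap_right_num)
  show "right_tabloid n \<mu> (rowmap_tabloid R) (a_perm n \<mu> ls [^]\<^bsub>sym_group (total_size n \<mu>)\<^esub> k) =
      rowmap_tabloid (\<lambda>y\<in>labels. row_shift (- k) (R y))"
    unfolding right_tabloid_def using T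
    by (auto simp: rowmap_tabloid_def tabloid_eq_rowmap_tabloid right_num_in_numberings
        rowmap_right_num)
qed

theorem bij_betw_fixed_tabloids:
  fixes j :: int
  assumes \<sigma>: "\<sigma> permutes labels"
  shows "bij_betw rowmap_tabloid
    {R \<in> rowmaps. \<forall>y\<in>labels. R (\<sigma> y) = row_shift (- j) (R y)}
    {X \<in> tabloids n \<mu>. left_tabloid n \<mu> \<sigma> X =
       right_tabloid n \<mu> X (a_perm n \<mu> ls [^]\<^bsub>sym_group (total_size n \<mu>)\<^esub> (- j))}"
proof (rule bij_betw_Collect[OF bij_betw_rowmap_tabloid])
  fix R assume R: "R \<in> rowmaps"
  let ?a = "a_perm n \<mu> ls [^]\<^bsub>sym_group (total_size n \<mu>)\<^esub> (- j)"
  let ?L = "\<lambda>y\<in>labels. R (inv' \<sigma> y)" and ?S = "\<lambda>y\<in>labels. row_shift j (R y)"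
  have "?S \<in> rowmaps"
    using shifted_rowmap_in_rowmaps[OF R, of "- j"] by simp
  then have "left_tabloid n \<mu> \<sigma> (rowmap_tabloid R) = right_tabloid n \<mu> (rowmap_tabloid R) ?a \<longleftrightarrow>
      ?L = ?S"
    using inj_on_eq_iff[OF inj_on_rowmap_tabloid permuted_rowmap_in_rowmaps[OF \<sigma> R]]
    by (simp add: left_tabloid_rowmap_tabloid[OF \<sigma> R] right_tabloid_rowmap_tabloid[OF R])
  also have "\<dots> \<longleftrightarrow> (\<forall>y\<in>labels. R (inv' \<sigma> y) = row_shift j (R y))"
    by (auto simp: restrict_def fun_eq_iff simp del: atLeastAtMost_iff split: if_splits)
  also have "\<dots> \<longleftrightarrow> (\<forall>y\<in>labels. R y = row_shift j (R (\<sigma> y)))"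
    using permutes_inverses[OF \<sigma>] permutes_in_image[OF \<sigma>] permutes_in_image[OF permutes_inv[OF \<sigma>]]
    by metis
  also have "\<dots> \<longleftrightarrow> (\<forall>y\<in>labels. R (\<sigma> y) = row_shift (- j) (R y))"
    using row_shift_eq_iff by metis
  finally show "left_tabloid n \<mu> \<sigma> (rowmap_tabloid R) = right_tabloid n \<mu> (rowmap_tabloid R) ?a \<longleftrightarrow>
      (\<forall>y\<in>labels. R (\<sigma> y) = row_shift (- j) (R y))" .
qed

end

section \<open>Row maps as assignments of rows to cycles\<close>

locale rotated_multipartition = l_multipartition +
  fixes j :: int and \<gamma> :: "nat \<Rightarrow> nat" and \<rho> :: "nat list"
  assumes n_pos: "0 < n"
    and \<gamma>_eq: "h \<in> {1..n} \<Longrightarrow> \<gamma> h = ls h div gcd (ls h) (nat \<bar>j\<bar>)"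
    and \<rho>_pos: "r \<in> set \<rho> \<Longrightarrow> 0 < r"
begin

abbreviation I :: "nat set" where
  "I \<equiv> {1..length \<rho>}"

definition gap :: "nat \<Rightarrow> nat" where
  "gap h = gcd (ls h) (nat \<bar>j\<bar>)"

definition row_base :: "nat \<times> nat \<Rightarrow> nat" where
  "row_base = (\<lambda>(i, h). class_base (ls h) (gap h) i)"

definition row_offset :: "nat \<times> nat \<Rightarrow> nat" where
  "row_offset = (\<lambda>(i, h). class_offset (ls h) (gap h) i)"

definition same_class :: "nat \<times> nat \<Rightarrow> nat \<times> nat \<Rightarrow> bool" where
  "same_class p q \<longleftrightarrow> snd p = snd q \<and> row_base p = row_base q"

definition multiplicity_in_row :: "(nat \<Rightarrow> nat \<times> nat) \<Rightarrow> nat \<times> nat \<Rightarrow> nat \<Rightarrow> nat" where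
  "multiplicity_in_row F p k = (if same_class (F k) p then part \<rho> k div \<gamma> (snd (F k)) else 0)"

definition assignments :: "(nat \<Rightarrow> nat \<times> nat) set" where
  "assignments = {F \<in> I \<rightarrow>\<^sub>E rows. (\<forall>k\<in>I. \<gamma> (snd (F k)) dvd part \<rho> k) \<and>
     (\<forall>p\<in>rows. (\<Sum>k\<in>I. multiplicity_in_row F p k) = row_length p)}"

lemma card_orbit_row_shift:
  assumes "p \<in> rows"
  shows "card (orbit (row_shift (- j)) p) = \<gamma> (snd p)"
proof -
  obtain i h where p_eq: "p = (i, h)"
    by (cases p)
  then have h: "h \<in> {1..n}"
    using assms by (simp add: rows_def)
  have "card (orbit (row_shift (- j)) p) dvd e \<longleftrightarrow> \<gamma> h dvd e" for e
  proof -
    have "card (orbit (row_shift (- j)) p) dvd e \<longleftrightarrow> row_shift (- j * int e) p = p"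
      using funpow_eq_self_iff[OF row_shift_permutation] by (simp only: row_shift_funpow)
    also have "\<dots> \<longleftrightarrow> int (ls h) dvd j * int e"
      using assms by (simp add: p_eq row_shift_eq_self_iff)
    also have "\<dots> \<longleftrightarrow> \<gamma> h dvd e"
      using dvd_mult_iff_div_gcd_dvd[OF ls_pos[OF h]] by (simp only: \<gamma>_eq[OF h] int_dvd_int_iff)
    finally show ?thesis .
  qed
  then show ?thesis
    unfolding p_eq snd_conv by (metis dvd_antisym dvd_refl)
qed

lemma orbit_row_shift_iff:
  assumes p: "p \<in> rows" and q: "q \<in> rows"
  shows "q \<in> orbit (row_shift (- j)) p \<longleftrightarrow> same_class p q"
proof -
  obtain i h i' h' where pq_eq: "p = (i, h)" "q = (i', h')"
    by (cases p; cases q)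
  have "q \<in> orbit (row_shift (- j)) p \<longleftrightarrow> (\<exists>e::nat. row_shift (- j * int e) p = q)"
    unfolding orbit_altdef_permutation[OF row_shift_permutation] row_shift_funpow by blast
  also have "\<dots> \<longleftrightarrow> h = h' \<and> (\<exists>e::nat. cyclic_shift (ls h) (- j * int e) i = i')"
    using p by (auto simp: pq_eq row_shift_apply)
  also have "\<dots> \<longleftrightarrow> same_class p q"
    using p q ex_cyclic_shift_eq_iff[of "ls h" i i' "gap h" j]
    by (auto simp: pq_eq rows_def same_class_def row_base_def gap_def ls_pos)
  finally show ?thesis .
qed

lemma card_fibre_eq_sum_multiplicities:
  assumes "orbit_representatives \<sigma> labels I rep"
    and part: "\<And>k. k \<in> I \<Longrightarrow> part \<rho> k = card (orbit \<sigma> (rep k))"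
    and R: "R \<in> equivariant_maps labels \<sigma> rows (row_shift (- j))" and p: "p \<in> rows"
  shows "card {y \<in> labels. R y = p} = (\<Sum>k\<in>I. multiplicity_in_row (\<lambda>k\<in>I. R (rep k)) p k)"
proof -
  interpret orbit_representatives \<sigma> labels I rep
    by fact
  have "(if p \<in> orbit (row_shift (- j)) (R (rep k))
      then card (orbit \<sigma> (rep k)) div card (orbit (row_shift (- j)) (R (rep k))) else 0) =
      multiplicity_in_row (\<lambda>k\<in>I. R (rep k)) p k" if k: "k \<in> I" for k
  proof -
    have "R (rep k) \<in> rows"
      using R rep_in[OF k] by (auto simp: equivariant_maps_def)
    then show ?thesis
      using p k
      by (simp add: orbit_row_shift_iff card_orbit_row_shift multiplicity_in_row_def part)
  qed
  then show ?thesis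
    unfolding card_equivariant_fibre[OF row_shift_permutation R] by (intro sum.cong) auto
qed

theorem bij_betw_assignments:
  assumes \<sigma>: "\<sigma> permutes labels" and \<rho>: "\<rho> = cycle_type (total_size n \<mu>) \<sigma>"
  obtains f where
    "bij_betw f {R \<in> rowmaps. \<forall>y\<in>labels. R (\<sigma> y) = row_shift (- j) (R y)} assignments"
proof -
  let ?P = "row_shift (- j)"
  obtain rep where representatives: "orbit_representatives \<sigma> labels I rep"
    and part: "\<And>k. k \<in> I \<Longrightarrow> part \<rho> k = card (orbit \<sigma> (rep k))"
    using cycle_type_representatives[OF \<sigma>] unfolding \<rho> by metis
  interpret orbit_representatives \<sigma> labels I rep
    by (rule representatives)
  let ?f = "\<lambda>R. \<lambda>k\<in>I. R (rep k)"
  let ?\<E> = "equivariant_maps labels \<sigma> rows ?P"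
    and ?\<F> = "{F \<in> I \<rightarrow>\<^sub>E rows. \<forall>k\<in>I. card (orbit ?P (F k)) dvd card (orbit \<sigma> (rep k))}"
  have "bij_betw ?f {R \<in> ?\<E>. \<forall>p\<in>rows. card {y \<in> labels. R y = p} = row_length p}
      {F \<in> ?\<F>. \<forall>p\<in>rows. (\<Sum>k\<in>I. multiplicity_in_row F p k) = row_length p}"
  proof (rule bij_betw_Collect)
    show "bij_betw ?f ?\<E> ?\<F>"
      by (rule bij_betw_equivariant_maps[OF row_shift_permutes row_shift_permutation])
  qed (intro ball_cong refl;
      simp only: card_fibre_eq_sum_multiplicities[OF representatives part])
  moreover have "{R \<in> ?\<E>. \<forall>p\<in>rows. card {y \<in> labels. R y = p} = row_length p} =
      {R \<in> rowmaps. \<forall>y\<in>labels. R (\<sigma> y) = ?P (R y)}"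
    by (auto simp: rowmaps_def equivariant_maps_def)
  moreover have "(\<forall>k\<in>I. card (orbit ?P (F k)) dvd card (orbit \<sigma> (rep k))) \<longleftrightarrow>
      (\<forall>k\<in>I. \<gamma> (snd (F k)) dvd part \<rho> k)" if "F \<in> I \<rightarrow>\<^sub>E rows" for F
    by (intro ball_cong refl) (simp add: card_orbit_row_shift[OF PiE_mem[OF that]] part)
  then have "{F \<in> ?\<F>. \<forall>p\<in>rows. (\<Sum>k\<in>I. multiplicity_in_row F p k) = row_length p} = assignments"
    unfolding assignments_def by blast
  ultimately show ?thesis
    by (intro that[of ?f]) (simp only:)
qed

end

section \<open>Blocks\<close>

context rotated_multipartition
begin

text \<open>\<open>int_block k h i' j'\<close> is the set required in condition (ii). Its offset \<open>(i', j')\<close> is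
  \<open>(b - gap h, a)\<close> for \<open>block k h b a\<close>, so that \<open>b\<close> is the first row of the block.\<close>

definition block :: "nat \<Rightarrow> nat \<Rightarrow> nat \<Rightarrow> nat \<Rightarrow> box set" where
  "block k h b a = {(b + gap h * s, a + t, h) | s t. s < \<gamma> h \<and> 1 \<le> t \<and> t \<le> part \<rho> k div \<gamma> h}"

definition int_block :: "nat \<Rightarrow> nat \<Rightarrow> int \<Rightarrow> int \<Rightarrow> (int \<times> int \<times> nat) set" where
  "int_block k h i' j' = {(int s * int (ls h div \<gamma> h) + i', int t + j', h) | s t.
     1 \<le> s \<and> s \<le> \<gamma> h \<and> 1 \<le> t \<and> t \<le> part \<rho> k div \<gamma> h}"

abbreviation int_box :: "box \<Rightarrow> int \<times> int \<times> nat" where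
  "int_box \<equiv> \<lambda>(i, x, h). (int i, int x, h)"

lemma part_\<rho>_pos_iff: "0 < part \<rho> k \<longleftrightarrow> k \<in> I"
  by (rule part_pos_iff[OF \<rho>_pos])

lemma gap_dvd: "gap h dvd ls h"
  unfolding gap_def by (rule gcd_dvd1)

lemma gap_\<gamma>: "h \<in> {1..n} \<Longrightarrow> ls h = gap h * \<gamma> h"
  unfolding \<gamma>_eq gap_def[symmetric] by (rule dvd_mult_div_cancel[OF gap_dvd, symmetric])

lemma
  assumes "h \<in> {1..n}"
  shows gap_pos: "0 < gap h" and \<gamma>_pos: "0 < \<gamma> h" and ls_div_\<gamma>: "ls h div \<gamma> h = gap h"
proof -
  have "0 < gap h * \<gamma> h"
    using gap_\<gamma>[OF assms] ls_pos[OF assms] by simp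
  then show "0 < gap h" "0 < \<gamma> h"
    by simp_all
  then show "ls h div \<gamma> h = gap h"
    by (simp add: gap_\<gamma>[OF assms])
qed

lemma width_pos:
  assumes "h \<in> {1..n}" "\<gamma> h dvd part \<rho> k" "k \<in> I"
  shows "0 < part \<rho> k div \<gamma> h"
  using assms part_\<rho>_pos_iff[of k] \<gamma>_pos[OF assms(1)] dvd_imp_le by (simp add: div_greater_zero_iff)

lemma row_base_pos: "0 < row_base p"
  by (cases p) (simp add: row_base_def)

lemma row_base_offset:
  assumes "0 < fst p"
  shows "row_base p + gap (snd p) * row_offset p = fst p"
  using class_base_offset[OF gap_dvd, of "fst p" "snd p"] assms(1)
  by (cases p) (simp add: row_base_def row_offset_def)

lemma row_offset_less:
  assumes "snd p \<in> {1..n}"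
  shows "row_offset p < \<gamma> (snd p)"
  using class_offset_less[OF gap_\<gamma>[OF assms] ls_pos[OF assms]]
  by (cases p) (simp add: row_offset_def)

lemma
  assumes "h \<in> {1..n}" "s < \<gamma> h"
  shows row_base_row: "row_base (row_base (i, h) + gap h * s, h) = row_base (i, h)"
    and row_offset_row: "row_offset (row_base (i, h) + gap h * s, h) = s"
  using class_base_row[OF gap_\<gamma>[OF assms(1)] ls_pos[OF assms(1)] assms(2), of i]
    class_offset_row[OF gap_\<gamma>[OF assms(1)] ls_pos[OF assms(1)] assms(2), of i]
  by (simp_all add: row_base_def row_offset_def)

lemma same_class_row_base:
  assumes "snd p \<in> {1..n}"
  shows "same_class p (row_base p, snd p)"
  using row_base_row[OF assms \<gamma>_pos[OF assms], of "fst p"] by (simp add: same_class_def)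

lemma
  assumes p: "p \<in> rows" and q_pos: "0 < fst q" and same: "same_class p q"
  shows same_class_in_rows: "q \<in> rows" and row_length_same_class: "row_length q = row_length p"
proof -
  obtain i i' h where pq_eq: "p = (i, h)" "q = (i', h)"
    using same by (cases p; cases q) (simp add: same_class_def)
  have h: "h \<in> {1..n}" and row_pos: "0 < i" "0 < i'"
    using p q_pos by (auto simp: pq_eq rows_def)
  have "row_group (ls h) i' = row_group (ls h) i"
    using same class_base_eq_iff[OF gap_dvd ls_pos[OF h] row_pos]
    by (simp add: pq_eq same_class_def row_base_def)
  then have "part (\<mu> h) i' = part (\<mu> h) i"
    by (rule part_row_group[OF h row_pos(2,1)])
  then show "q \<in> rows" "row_length q = row_length p"
    using p row_pos by (auto simp: pq_eq rows_def row_length_def)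
qed

lemma row_base_box_in_boxes:
  assumes "(i, x, h) \<in> B"
  shows "(row_base (i, h), x, h) \<in> B"
proof -
  have row: "(i, h) \<in> rows"
    using assms by (simp add: boxes_iff)
  have same: "same_class (i, h) (row_base (i, h), h)"
    using same_class_row_base[OF rowsD(1)[OF row]] by simp
  show ?thesis
    using assms same_class_in_rows[OF row _ same] row_length_same_class[OF row _ same]
    by (simp add: boxes_iff row_base_pos)
qed

lemma row_eqI:
  assumes "p \<in> rows" "q \<in> rows" "same_class p q" "row_offset p = row_offset q"
  shows "p = q"
  using assms row_base_offset[OF rowsD(2)[OF assms(1)]] row_base_offset[OF rowsD(2)[OF assms(2)]]
  by (simp add: same_class_def prod_eq_iff)

lemma in_block_iff:
  assumes h: "snd p \<in> {1..n}" and i_pos: "0 < i"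
  shows "(i, x, h) \<in> block k (snd p) (row_base p) a \<longleftrightarrow>
    same_class p (i, h) \<and> a < x \<and> x \<le> a + part \<rho> k div \<gamma> (snd p)"
proof
  assume "(i, x, h) \<in> block k (snd p) (row_base p) a"
  then obtain s t where "s < \<gamma> (snd p)" "i = row_base p + gap (snd p) * s" "h = snd p"
      "x = a + t" "1 \<le> t" "t \<le> part \<rho> k div \<gamma> (snd p)"
    by (auto simp: block_def)
  then show "same_class p (i, h) \<and> a < x \<and> x \<le> a + part \<rho> k div \<gamma> (snd p)"
    using row_base_row[OF assms(1), of s "fst p"] by (simp add: same_class_def)
next
  assume same: "same_class p (i, h) \<and> a < x \<and> x \<le> a + part \<rho> k div \<gamma> (snd p)"
  then have "h = snd p" "i = row_base p + gap h * row_offset (i, h)"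
    using row_base_offset[of "(i, h)"] i_pos by (auto simp: same_class_def)
  then show "(i, x, h) \<in> block k (snd p) (row_base p) a"
    unfolding block_def using same row_offset_less[of "(i, h)"] h
    by (intro CollectI exI[of _ "row_offset (i, h)"] exI[of _ "x - a"]) auto
qed

lemma block_corner:
  assumes "h \<in> {1..n}" "\<gamma> h dvd part \<rho> k" "k \<in> I"
  shows "(b, a + 1, h) \<in> block k h b a"
  unfolding block_def using width_pos[OF assms] \<gamma>_pos[OF assms(1)]
  by (intro CollectI exI[of _ 0] exI[of _ 1]) (auto simp: Suc_le_eq)

lemma card_block:
  assumes h: "h \<in> {1..n}" and dvd: "\<gamma> h dvd part \<rho> k"
  shows "card (block k h b a) = part \<rho> k"
proof -
  let ?f = "\<lambda>(s, t). (b + gap h * s, a + t, h)" and ?A = "{..<\<gamma> h} \<times> {1..part \<rho> k div \<gamma> h}"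
  have "block k h b a = ?f ` ?A"
    by (auto simp: block_def image_iff)
  moreover have "inj_on ?f ?A"
    using gap_pos[OF h] by (auto simp: inj_on_def)
  ultimately show ?thesis
    using dvd by (simp add: card_image card_cartesian_product)
qed

lemma image_int_block:
  assumes h: "h \<in> {1..n}"
  shows "int_box ` block k h b a = int_block k h (int b - int (gap h)) (int a)" (is "_ = ?R")
proof (intro equalityI subsetI)
  fix z assume "z \<in> int_box ` block k h b a"
  then obtain s t where "s < \<gamma> h" "1 \<le> t" "t \<le> part \<rho> k div \<gamma> h"
      "z = (int (b + gap h * s), int (a + t), h)"
    by (auto simp: block_def)
  then show "z \<in> ?R"
    unfolding int_block_def ls_div_\<gamma>[OF h]
    by (intro CollectI exI[of _ "Suc s"] exI[of _ t]) (auto simp: algebra_simps)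
next
  fix z assume "z \<in> ?R"
  then obtain s t where "s < \<gamma> h" "1 \<le> t" "t \<le> part \<rho> k div \<gamma> h"
    and z_eq: "z = (int (Suc s) * int (gap h) + (int b - int (gap h)), int t + int a, h)"
    unfolding int_block_def ls_div_\<gamma>[OF h] by (force simp: Suc_le_eq gr0_conv_Suc)
  then have "(b + gap h * s, a + t, h) \<in> block k h b a"
    by (auto simp: block_def)
  then show "z \<in> int_box ` block k h b a"
    by (rule rev_image_eqI) (simp add: z_eq algebra_simps)
qed

lemma block_if_image_int_eq:
  assumes h: "h \<in> {1..n}" and dvd: "\<gamma> h dvd part \<rho> k" and k: "k \<in> I" and subset: "A \<subseteq> B"
    and image: "int_box ` A = int_block k h i' j'"
  obtains b a where "A = block k h b a"
proof -
  have "(int 1 * int (ls h div \<gamma> h) + i', int 1 + j', h) \<in> int_box ` A"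
    unfolding image int_block_def using \<gamma>_pos[OF h] width_pos[OF h dvd k]
    by (intro CollectI exI[of _ 1]) (simp add: Suc_le_eq)
  then obtain b x where corner: "(b, x, h) \<in> A" "int b = int (gap h) + i'" "int x = 1 + j'"
    unfolding ls_div_\<gamma>[OF h] by auto
  then have "1 \<le> x"
    using subset by (auto simp: boxes_def)
  with corner have "i' = int b - int (gap h)" "j' = int (x - 1)"
    by simp_all
  then have "int_box ` A = int_box ` block k h b (x - 1)"
    by (simp only: image image_int_block[OF h])
  moreover have "inj int_box"
    by (auto simp: inj_def)
  ultimately show ?thesis
    using that by (simp add: inj_image_eq_iff)
qed

definition weakly_increasing_rows :: "(box \<Rightarrow> nat) \<Rightarrow> bool" where
  "weakly_increasing_rows Y \<longleftrightarrow>
     (\<forall>(i, h)\<in>rows. mono_on {1..row_length (i, h)} (\<lambda>x. Y (i, x, h)))"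

lemma weakly_increasing_rows_iff:
  "weakly_increasing_rows Y \<longleftrightarrow>
     (\<forall>i x y h. (i, x, h) \<in> B \<and> (i, y, h) \<in> B \<and> x \<le> y \<longrightarrow> Y (i, x, h) \<le> Y (i, y, h))"
  by (auto simp: weakly_increasing_rows_def boxes_iff monotone_on_def)

lemma rho_tabloids_altdef:
  "Y \<in> rho_tabloids \<rho> \<gamma> n ls \<mu> \<longleftrightarrow> Y \<in> B \<rightarrow>\<^sub>E {1..} \<and> (\<forall>k\<ge>1. card (preim n \<mu> Y k) = part \<rho> k) \<and>
     (\<forall>k\<ge>1. \<exists>h\<in>{1..n}. \<exists>i' j'. \<gamma> h dvd part \<rho> k \<and> int_box ` preim n \<mu> Y k = int_block k h i' j') \<and>
     weakly_increasing_rows Y"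
  unfolding rho_tabloids_def int_block_def weakly_increasing_rows_iff mem_Collect_eq ..

lemma rho_tabloid_value:
  assumes Y: "Y \<in> rho_tabloids \<rho> \<gamma> n ls \<mu>" and b: "b \<in> B"
  shows "Y b \<in> I"
proof -
  have "1 \<le> Y b" and "\<And>k. 1 \<le> k \<Longrightarrow> card (preim n \<mu> Y k) = part \<rho> k"
    using Y b unfolding rho_tabloids_altdef by auto
  moreover have "b \<in> preim n \<mu> Y (Y b)" and "finite (preim n \<mu> Y (Y b))"
    using b finite_boxes by (simp_all add: preim_def)
  then have "0 < card (preim n \<mu> Y (Y b))"
    by (auto simp: card_gt_0_iff)
  ultimately show ?thesis
    using part_\<rho>_pos_iff by simp
qed

lemma rho_tabloid_ex_block:
  assumes Y: "Y \<in> rho_tabloids \<rho> \<gamma> n ls \<mu>" and k: "k \<in> I"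
  shows "\<exists>h\<in>{1..n}. \<gamma> h dvd part \<rho> k \<and> (\<exists>b a. preim n \<mu> Y k = block k h b a)"
proof -
  obtain h i' j' where h: "h \<in> {1..n}" "\<gamma> h dvd part \<rho> k"
    and image: "int_box ` preim n \<mu> Y k = int_block k h i' j'"
    using Y k unfolding rho_tabloids_altdef by (metis atLeastAtMost_iff)
  have "preim n \<mu> Y k \<subseteq> B"
    by (auto simp: preim_def)
  from block_if_image_int_eq[OF h k this image] show ?thesis
    using h by metis
qed

lemma rho_tabloidI:
  assumes Y: "Y \<in> B \<rightarrow>\<^sub>E I" and increasing: "weakly_increasing_rows Y"
    and block: "\<And>k. k \<in> I \<Longrightarrow>
      \<exists>h\<in>{1..n}. \<gamma> h dvd part \<rho> k \<and> (\<exists>b a. preim n \<mu> Y k = block k h b a)"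
  shows "Y \<in> rho_tabloids \<rho> \<gamma> n ls \<mu>"
proof -
  have "card (preim n \<mu> Y k) = part \<rho> k \<and>
      (\<exists>h\<in>{1..n}. \<exists>i' j'. \<gamma> h dvd part \<rho> k \<and> int_box ` preim n \<mu> Y k = int_block k h i' j')" for k
  proof (cases "k \<in> I")
    case True
    then obtain h b a where "h \<in> {1..n}" "\<gamma> h dvd part \<rho> k" "preim n \<mu> Y k = block k h b a"
      using block by blast
    then show ?thesis
      using card_block image_int_block by metis
  next
    case False
    then have "part \<rho> k = 0" and "preim n \<mu> Y k = {}"
      using part_\<rho>_pos_iff[of k] Y by (auto simp: preim_def)
    then show ?thesis
      using n_pos by (intro conjI bexI[of _ 1] exI[of _ 0]) (auto simp: int_block_def Suc_le_eq)
  qed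
  moreover have "Y \<in> B \<rightarrow>\<^sub>E {1..}"
    using Y by (auto simp: PiE_iff)
  ultimately show ?thesis
    using increasing unfolding rho_tabloids_altdef by blast
qed

lemma rho_tabloids_iff:
  "Y \<in> rho_tabloids \<rho> \<gamma> n ls \<mu> \<longleftrightarrow> Y \<in> B \<rightarrow>\<^sub>E I \<and> weakly_increasing_rows Y \<and>
     (\<forall>k\<in>I. \<exists>h\<in>{1..n}. \<gamma> h dvd part \<rho> k \<and> (\<exists>b a. preim n \<mu> Y k = block k h b a))"
proof
  assume Y: "Y \<in> rho_tabloids \<rho> \<gamma> n ls \<mu>"
  then have "Y \<in> B \<rightarrow>\<^sub>E I" "weakly_increasing_rows Y"
    using rho_tabloid_value[OF Y] by (simp_all add: rho_tabloids_altdef PiE_iff)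
  then show "Y \<in> B \<rightarrow>\<^sub>E I \<and> weakly_increasing_rows Y \<and>
     (\<forall>k\<in>I. \<exists>h\<in>{1..n}. \<gamma> h dvd part \<rho> k \<and> (\<exists>b a. preim n \<mu> Y k = block k h b a))"
    using rho_tabloid_ex_block[OF Y] by blast
qed (use rho_tabloidI in blast)

text \<open>If a block started in a later row of its class, the box above its first row, in the first row
  of the class, would lie in a block that is aligned by induction and hence covers the whole class,
  leaving no room for the given block.\<close>

lemma block_aligned:
  assumes Y: "Y \<in> rho_tabloids \<rho> \<gamma> n ls \<mu>" and h: "h \<in> {1..n}"
  shows "\<lbrakk>k \<in> I; \<gamma> h dvd part \<rho> k; preim n \<mu> Y k = block k h b a\<rbrakk> \<Longrightarrow> row_base (b, h) = b"
proof (induction b arbitrary: k a rule: less_induct)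
  case (less b)
  let ?b' = "row_base (b, h)" and ?x = "a + 1"
  have corner: "(b, ?x, h) \<in> B" "Y (b, ?x, h) = k"
    using block_corner[OF h less.prems(2,1), of b a] less.prems(3) by (auto simp: preim_def)
  then have b_pos: "0 < b" and above: "(?b', ?x, h) \<in> B"
    using row_base_box_in_boxes[OF corner(1)] by (simp_all add: boxes_def)
  show ?case
  proof (rule ccontr)
    assume "?b' \<noteq> b"
    then have "?b' < b"
      using row_base_offset[of "(b, h)"] b_pos by simp
    define k' where "k' = Y (?b', ?x, h)"
    then have k': "k' \<in> I" and above_k': "(?b', ?x, h) \<in> preim n \<mu> Y k'"
      using rho_tabloid_value[OF Y above] above by (simp_all add: preim_def)
    then obtain h' c a' where block': "\<gamma> h' dvd part \<rho> k'" "preim n \<mu> Y k' = block k' h' c a'"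
      using Y unfolding rho_tabloids_iff by blast
    moreover have "h' = h" "c \<le> ?b'"
      using above_k' block'(2) by (auto simp: block_def)
    ultimately have "row_base (c, h) = c"
      using \<open>?b' < b\<close> by (intro less.IH[OF _ k']) simp_all
    then have "(i, ?x, h) \<in> preim n \<mu> Y k' \<longleftrightarrow>
        same_class (c, h) (i, h) \<and> a' < ?x \<and> ?x \<le> a' + part \<rho> k' div \<gamma> h" if "0 < i" for i
      using in_block_iff[of "(c, h)" i ?x h k' a'] h that block'(2) \<open>h' = h\<close> by simp
    moreover have "same_class (b, h) (?b', h)"
      using same_class_row_base[of "(b, h)"] h by simp
    ultimately have "(b, ?x, h) \<in> preim n \<mu> Y k'"
      using above_k' b_pos row_base_pos by (simp add: same_class_def)
    then have "k' = k"
      using corner(2) by (simp add: preim_def)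
    then have "(?b', ?x, h) \<in> block k h b a"
      using above_k' less.prems(3) by simp
    then show False
      using \<open>?b' < b\<close> by (auto simp: block_def)
  qed
qed

section \<open>Fillings and markings\<close>

definition filling :: "(nat \<Rightarrow> nat \<times> nat) \<Rightarrow> box \<Rightarrow> nat" where
  "filling F = (\<lambda>(i, x, h)\<in>B. sorted_word (multiplicity_in_row F (i, h)) x)"

definition marking :: "(nat \<Rightarrow> nat \<times> nat) \<Rightarrow> nat \<Rightarrow> nat \<times> int" where
  "marking F = (\<lambda>k\<in>I. (snd (F k), int (row_offset (F k))))"

definition block_in_class :: "(box \<Rightarrow> nat) \<Rightarrow> nat \<Rightarrow> nat \<times> nat \<Rightarrow> bool" where
  "block_in_class Y k p \<longleftrightarrow>
     \<gamma> (snd p) dvd part \<rho> k \<and> (\<exists>a. preim n \<mu> Y k = block k (snd p) (row_base p) a)"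

definition realizes :: "(nat \<Rightarrow> nat \<times> nat) \<Rightarrow> (box \<Rightarrow> nat) \<Rightarrow> bool" where
  "realizes F Y \<longleftrightarrow> F \<in> I \<rightarrow>\<^sub>E rows \<and> Y \<in> B \<rightarrow>\<^sub>E I \<and> weakly_increasing_rows Y \<and>
     (\<forall>k\<in>I. block_in_class Y k (F k))"

lemma block_in_class_corner:
  assumes "block_in_class Y k p" "p \<in> rows" "k \<in> I"
  obtains x where "(row_base p, x, snd p) \<in> preim n \<mu> Y k"
  using assms(1) block_corner[OF rowsD(1)[OF assms(2)] _ assms(3)] that
  by (auto simp: block_in_class_def simp del: One_nat_def)

lemma same_class_if_in_preim:
  assumes "block_in_class Y k p" "p \<in> rows" "(i, x, h) \<in> preim n \<mu> Y k"
  shows "same_class p (i, h)"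
proof -
  have "0 < i"
    using assms(3) by (simp add: preim_def boxes_def)
  then show ?thesis
    using assms(1,3) in_block_iff[OF rowsD(1)[OF assms(2)]] by (auto simp: block_in_class_def)
qed

lemma card_row_eq_multiplicity:
  assumes F: "realizes F Y" and p: "(i, h) \<in> rows"
  shows "card {x \<in> {1..row_length (i, h)}. Y (i, x, h) = k} = multiplicity_in_row F (i, h) k"
proof (cases "k \<in> I")
  case True
  have Fk: "F k \<in> rows" "block_in_class Y k (F k)"
    using F True by (auto simp: realizes_def)
  then obtain a where block: "preim n \<mu> Y k = block k (snd (F k)) (row_base (F k)) a"
    by (auto simp: block_in_class_def)
  have "{x \<in> {1..row_length (i, h)}. Y (i, x, h) = k} = {x. (i, x, h) \<in> preim n \<mu> Y k}"
    using p by (auto simp: preim_def boxes_iff)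
  also have "\<dots> = {x. same_class (F k) (i, h) \<and> x \<in> {a<..a + part \<rho> k div \<gamma> (snd (F k))}}"
    using in_block_iff[OF rowsD(1)[OF Fk(1)]] rowsD(2)[OF p] by (simp add: block)
  finally show ?thesis
    by (cases "same_class (F k) (i, h)")
      (simp_all add: multiplicity_in_row_def del: greaterThanAtMost_iff)
next
  case False
  then have "{x \<in> {1..row_length (i, h)}. Y (i, x, h) = k} = {}"
    using F p by (auto simp: realizes_def boxes_iff)
  moreover have "part \<rho> k = 0"
    using False part_\<rho>_pos_iff[of k] by (metis neq0_conv)
  ultimately show ?thesis
    by (simp add: multiplicity_in_row_def)
qed

lemma realizes_imp_assignment:
  assumes F: "realizes F Y"
  shows "F \<in> assignments"
proof -
  have "(\<Sum>k\<in>I. multiplicity_in_row F (i, h) k) = row_length (i, h)" if p: "(i, h) \<in> rows" for i h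
  proof -
    have "(\<Sum>k\<in>I. multiplicity_in_row F (i, h) k) =
        (\<Sum>k\<in>I. card {x \<in> {1..row_length (i, h)}. Y (i, x, h) = k})"
      by (simp only: card_row_eq_multiplicity[OF F p])
    also have "\<dots> = card (\<Union>k\<in>I. {x \<in> {1..row_length (i, h)}. Y (i, x, h) = k})"
      by (subst card_UN_disjoint) auto
    also have "(\<Union>k\<in>I. {x \<in> {1..row_length (i, h)}. Y (i, x, h) = k}) = {1..row_length (i, h)}"
      using F p by (auto simp: realizes_def boxes_iff)
    finally show ?thesis
      by simp
  qed
  then show ?thesis
    using F by (auto simp: assignments_def realizes_def block_in_class_def)
qed

lemma realizes_imp_eq_filling:
  assumes F: "realizes F Y"
  shows "Y = filling F"
proof (rule extensionalityI[of _ B])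
  show "Y \<in> extensional B"
    using F by (simp add: realizes_def PiE_def)
  show "filling F \<in> extensional B"
    by (simp add: filling_def)
  fix b assume "b \<in> B"
  moreover obtain i x h where b_eq: "b = (i, x, h)"
    by (rule prod_cases3)
  ultimately have p: "(i, h) \<in> rows" and x: "x \<in> {1..row_length (i, h)}"
    by (simp_all add: boxes_iff)
  have "mono_on {1..row_length (i, h)} (\<lambda>x. Y (i, x, h))"
    using F p by (auto simp: realizes_def weakly_increasing_rows_def)
  moreover have "0 < Y (i, y, h)" if "y \<in> {1..row_length (i, h)}" for y
  proof -
    have "Y (i, y, h) \<in> I"
      by (rule PiE_mem[of Y B]) (use F p that in \<open>simp_all add: realizes_def boxes_iff\<close>)
    then show ?thesis
      by simp
  qed
  ultimately have "sorted_word (multiplicity_in_row F (i, h)) x = Y (i, x, h)"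
    using sorted_word_of_mono_on[of "row_length (i, h)" "\<lambda>x. Y (i, x, h)"] x
    by (simp only: card_row_eq_multiplicity[OF F p])
  then show "Y b = filling F b"
    using \<open>b \<in> B\<close> by (simp add: b_eq filling_def)
qed

lemma multiplicity_same_class: "same_class p q \<Longrightarrow> multiplicity_in_row F p = multiplicity_in_row F q"
  by (auto simp: multiplicity_in_row_def same_class_def fun_eq_iff)

lemma
  assumes F: "F \<in> assignments" and b: "(i, x, h) \<in> B"
  shows filling_in_index: "filling F (i, x, h) \<in> I"
    and filling_eq_iff: "k \<in> I \<Longrightarrow> filling F (i, x, h) = k \<longleftrightarrow>
      (\<Sum>k'\<in>{1..<k}. multiplicity_in_row F (i, h) k') < x \<and>
      x \<le> (\<Sum>k'\<in>{1..<k}. multiplicity_in_row F (i, h) k') + multiplicity_in_row F (i, h) k"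
proof -
  have filling: "filling F (i, x, h) = sorted_word (multiplicity_in_row F (i, h)) x"
    using b by (simp add: filling_def)
  have total: "x \<le> (\<Sum>k\<in>I. multiplicity_in_row F (i, h) k)" and x_pos: "0 < x"
    using F b by (auto simp: assignments_def boxes_iff)
  show "filling F (i, x, h) \<in> I"
    unfolding filling using sorted_word_pos[OF x_pos total] sorted_word_le_iff[OF total] total
    by simp
  show "filling F (i, x, h) = k \<longleftrightarrow>
      (\<Sum>k'\<in>{1..<k}. multiplicity_in_row F (i, h) k') < x \<and>
      x \<le> (\<Sum>k'\<in>{1..<k}. multiplicity_in_row F (i, h) k') + multiplicity_in_row F (i, h) k"
    if "k \<in> I"
    unfolding filling using that by (intro sorted_word_eq_iff[OF total]) simp
qed

lemma weakly_increasing_filling: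
  assumes F: "F \<in> assignments"
  shows "weakly_increasing_rows (filling F)"
  unfolding weakly_increasing_rows_iff
proof (intro allI impI, elim conjE)
  fix i x y h assume b: "(i, x, h) \<in> B" "(i, y, h) \<in> B" and "x \<le> y"
  moreover have "y \<le> (\<Sum>k\<in>I. multiplicity_in_row F (i, h) k)"
    using F b(2) by (auto simp: assignments_def boxes_iff)
  ultimately show "filling F (i, x, h) \<le> filling F (i, y, h)"
    using sorted_word_mono by (simp add: filling_def)
qed

lemma block_subset_boxes:
  assumes F: "F \<in> assignments" and k: "k \<in> I"
  shows "block k (snd (F k)) (row_base (F k)) (\<Sum>k'\<in>{1..<k}. multiplicity_in_row F (F k) k') \<subseteq> B"
proof clarify
  let ?a = "\<Sum>k'\<in>{1..<k}. multiplicity_in_row F (F k) k'"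
  fix i x h assume block: "(i, x, h) \<in> block k (snd (F k)) (row_base (F k)) ?a"
  have Fk: "F k \<in> rows"
    using F k by (auto simp: assignments_def)
  have i_pos: "0 < i"
    using block row_base_pos[of "F k"] by (auto simp: block_def)
  have same: "same_class (F k) (i, h)" and column: "?a < x" "x \<le> ?a + part \<rho> k div \<gamma> (snd (F k))"
    using block in_block_iff[OF rowsD(1)[OF Fk] i_pos] by auto
  note column(2)
  also have "?a + part \<rho> k div \<gamma> (snd (F k)) =
      (\<Sum>k'\<in>insert k {1..<k}. multiplicity_in_row F (F k) k')"
    by (simp add: multiplicity_in_row_def[of F "F k" k] same_class_def)
  also have "\<dots> \<le> (\<Sum>k'\<in>I. multiplicity_in_row F (F k) k')"
    using k by (intro sum_mono2) auto
  also have "\<dots> = row_length (i, h)"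
    using F Fk row_length_same_class[OF Fk _ same] i_pos by (simp add: assignments_def)
  finally show "(i, x, h) \<in> B"
    using same_class_in_rows[OF Fk _ same] i_pos column(1) by (simp add: boxes_iff)
qed

lemma preim_filling:
  assumes F: "F \<in> assignments" and k: "k \<in> I"
  shows "preim n \<mu> (filling F) k =
    block k (snd (F k)) (row_base (F k)) (\<Sum>k'\<in>{1..<k}. multiplicity_in_row F (F k) k')"
    (is "_ = ?block")
proof -
  have "F k \<in> rows"
    using F k by (auto simp: assignments_def)
  then have component: "snd (F k) \<in> {1..n}"
    by (rule rowsD)
  have "filling F (i, x, h) = k \<longleftrightarrow> (i, x, h) \<in> ?block" if b: "(i, x, h) \<in> B" for i x h
  proof (cases "same_class (F k) (i, h)")
    case True
    then have "multiplicity_in_row F (i, h) k = part \<rho> k div \<gamma> (snd (F k))"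
      by (simp add: multiplicity_in_row_def)
    then show ?thesis
      using filling_eq_iff[OF F b k] in_block_iff[OF component, of i] b True
      by (simp add: multiplicity_same_class[OF True] boxes_def)
  next
    case False
    then have "multiplicity_in_row F (i, h) k = 0"
      by (simp add: multiplicity_in_row_def)
    then show ?thesis
      using filling_eq_iff[OF F b k] in_block_iff[OF component, of i] b False
      by (simp add: boxes_def)
  qed
  then show ?thesis
    using block_subset_boxes[OF F k] by (auto simp: preim_def)
qed

lemma realizes_filling:
  assumes F: "F \<in> assignments"
  shows "realizes F (filling F)"
proof -
  have "filling F \<in> B \<rightarrow>\<^sub>E I"
    using filling_in_index[OF F] by (intro PiE_I) (auto simp: filling_def)
  then show ?thesis
    using F weakly_increasing_filling[OF F] preim_filling[OF F]
    by (auto simp: realizes_def block_in_class_def assignments_def)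
qed

lemma realizes_unique:
  assumes F: "realizes F Y" and F': "realizes F' Y" and marking: "marking F = marking F'"
  shows "F = F'"
proof (rule extensionalityI[of _ I])
  fix k assume k: "k \<in> I"
  have Fk: "F k \<in> rows" "block_in_class Y k (F k)"
    and F'k: "F' k \<in> rows" "block_in_class Y k (F' k)"
    using F F' k by (auto simp: realizes_def)
  have "snd (F k) = snd (F' k) \<and> row_offset (F k) = row_offset (F' k)"
    using fun_cong[OF marking, of k] k by (simp add: marking_def)
  moreover obtain x where "(row_base (F k), x, snd (F k)) \<in> preim n \<mu> Y k"
    using block_in_class_corner[OF Fk(2,1) k] .
  then have "same_class (F' k) (row_base (F k), snd (F k))"
    by (rule same_class_if_in_preim[OF F'k(2,1)])
  then have "same_class (F k) (F' k)"
    using same_class_row_base[OF rowsD(1)[OF Fk(1)]] by (simp add: same_class_def)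
  ultimately show "F k = F' k"
    using row_eqI[OF Fk(1) F'k(1)] by blast
qed (use F F' in \<open>auto simp: realizes_def PiE_def\<close>)

lemma marked_tabloids_iff:
  "(Y, c) \<in> marked_tabloids \<rho> \<gamma> n ls \<mu> \<longleftrightarrow> Y \<in> rho_tabloids \<rho> \<gamma> n ls \<mu> \<and>
     c \<in> I \<rightarrow>\<^sub>E (SIGMA h:{1..n}. {0..<int (\<gamma> h)}) \<and>
     (\<forall>k h. k \<in> I \<and> h \<in> {1..n} \<and> preim n \<mu> Y k \<subseteq> {(i, j, h') | i j h'. h' = h} \<longrightarrow> fst (c k) = h)"
proof -
  have "carrier (integer_mod_group (\<gamma> h)) = {0..<int (\<gamma> h)}" if "h \<in> {1..n}" for h
    using \<gamma>_pos[OF that] by (simp add: carrier_integer_mod_group)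
  then have "(SIGMA h:{1..n}. carrier (integer_mod_group (\<gamma> h))) =
      (SIGMA h:{1..n}. {0..<int (\<gamma> h)})"
    by (intro Sigma_cong) auto
  then show ?thesis
    unfolding marked_tabloids_def neq0_conv part_\<rho>_pos_iff
    by (simp only: mem_Collect_eq prod.case Collect_mem_eq)
qed

lemma realizes_imp_marked:
  assumes F: "realizes F Y"
  shows "(Y, marking F) \<in> marked_tabloids \<rho> \<gamma> n ls \<mu>"
proof -
  have Fk: "F k \<in> rows" "block_in_class Y k (F k)" if "k \<in> I" for k
    using F that by (auto simp: realizes_def)
  then have snd: "snd (F k) \<in> {1..n}" if "k \<in> I" for k
    using that rowsD(1) by blast
  then have "Y \<in> rho_tabloids \<rho> \<gamma> n ls \<mu>"
    using F unfolding realizes_def rho_tabloids_iff block_in_class_def by blast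
  moreover have "marking F \<in> I \<rightarrow>\<^sub>E (SIGMA h:{1..n}. {0..<int (\<gamma> h)})"
    using snd row_offset_less by (intro PiE_I) (auto simp: marking_def)
  moreover have "fst (marking F k) = h"
    if k: "k \<in> I" and sub: "preim n \<mu> Y k \<subseteq> {(i, j, h') | i j h'. h' = h}" for k h
  proof -
    obtain x where "(row_base (F k), x, snd (F k)) \<in> preim n \<mu> Y k"
      using block_in_class_corner[OF Fk(2,1)] k by blast
    then show ?thesis
      using sub k by (auto simp: marking_def)
  qed
  ultimately show ?thesis
    unfolding marked_tabloids_iff by blast
qed

lemma marked_block_row:
  assumes marked: "(Y, c) \<in> marked_tabloids \<rho> \<gamma> n ls \<mu>" and k: "k \<in> I"
  obtains p where "p \<in> rows" "block_in_class Y k p" "c k = (snd p, int (row_offset p))"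
proof -
  have Y: "Y \<in> rho_tabloids \<rho> \<gamma> n ls \<mu>" and mark: "c k \<in> (SIGMA h:{1..n}. {0..<int (\<gamma> h)})"
    and fst_c: "\<And>h. h \<in> {1..n} \<Longrightarrow> preim n \<mu> Y k \<subseteq> {(i, j, h') | i j h'. h' = h} \<Longrightarrow> fst (c k) = h"
    using marked k unfolding marked_tabloids_iff by blast+
  obtain h b a where h: "h \<in> {1..n}" and dvd: "\<gamma> h dvd part \<rho> k"
    and block: "preim n \<mu> Y k = block k h b a"
    using Y k unfolding rho_tabloids_iff by blast
  have aligned: "row_base (b, h) = b"
    by (rule block_aligned[OF Y h k dvd block])
  have "fst (c k) = h"
    by (rule fst_c[OF h]) (auto simp: block block_def)
  with mark obtain s where offset: "s < \<gamma> h" "c k = (h, int s)"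
    by (cases "c k") (auto simp: zless_nat_eq_int_zless dest: zero_le_imp_eq_int)
  let ?p = "(b + gap h * s, h)"
  have class_p: "row_base ?p = b" "row_offset ?p = s"
    using row_base_row[OF h offset(1), of b] row_offset_row[OF h offset(1), of b]
    by (simp_all add: aligned)
  have "(b, h) \<in> rows"
    using block_corner[OF h dvd k, of b a] unfolding block[symmetric]
    by (auto simp: preim_def boxes_iff)
  then have "?p \<in> rows"
    by (rule same_class_in_rows)
      (use aligned class_p row_base_pos[of ?p] in \<open>auto simp: same_class_def\<close>)
  moreover have "block_in_class Y k ?p"
    using dvd block class_p by (auto simp: block_in_class_def)
  ultimately show ?thesis
    using that offset(2) class_p(2) by simp
qed

lemma marked_imp_realized:
  assumes marked: "(Y, c) \<in> marked_tabloids \<rho> \<gamma> n ls \<mu>"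
  obtains F where "realizes F Y" "marking F = c"
proof -
  have "\<exists>F. \<forall>k\<in>I. F k \<in> rows \<and> block_in_class Y k (F k) \<and> c k = (snd (F k), int (row_offset (F k)))"
    using marked_block_row[OF marked] by (intro bchoice) metis
  then obtain F where F: "\<And>k. k \<in> I \<Longrightarrow> F k \<in> rows \<and> block_in_class Y k (F k) \<and>
      c k = (snd (F k), int (row_offset (F k)))"
    by blast
  have "realizes (restrict F I) Y"
    using F marked unfolding marked_tabloids_iff rho_tabloids_iff by (auto simp: realizes_def)
  moreover have "marking (restrict F I) = c"
  proof (rule extensionalityI[of _ I])
    show "c \<in> extensional I"
      using marked by (simp add: marked_tabloids_iff PiE_def)
  qed (use F in \<open>auto simp: marking_def\<close>)
  ultimately show ?thesis
    by (rule that)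
qed

theorem bij_betw_marked_tabloids:
  "bij_betw (\<lambda>F. (filling F, marking F)) assignments (marked_tabloids \<rho> \<gamma> n ls \<mu>)"
  unfolding bij_betw_def
proof (intro conjI equalityI subsetI)
  show "inj_on (\<lambda>F. (filling F, marking F)) assignments"
    using realizes_filling realizes_unique by (intro inj_onI) (metis prod.inject)
next
  fix z assume "z \<in> (\<lambda>F. (filling F, marking F)) ` assignments"
  then show "z \<in> marked_tabloids \<rho> \<gamma> n ls \<mu>"
    using realizes_imp_marked[OF realizes_filling] by blast
next
  fix z assume "z \<in> marked_tabloids \<rho> \<gamma> n ls \<mu>"
  moreover obtain Y c where z_eq: "z = (Y, c)"
    by (cases z)
  ultimately obtain F where "realizes F Y" "marking F = c"
    using marked_imp_realized by blast
  then show "z \<in> (\<lambda>F. (filling F, marking F)) ` assignments"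
    using realizes_imp_assignment realizes_imp_eq_filling z_eq by blast
qed

end

lemma cycle_type_pos:
  assumes "\<sigma> permutes {1..m}" "r \<in> set (cycle_type m \<sigma>)"
  shows "0 < r"
proof -
  have "permutation \<sigma>"
    using assms(1) permutation_permutes by blast
  moreover obtain os where "cycle_type m \<sigma> = map card os" "distinct os" "set os = orbit \<sigma> ` {1..m}"
    by (rule cycle_type_orbits)
  ultimately show ?thesis
    using assms(2) card_orbit_pos by auto
qed

theorem theorem3p2:
  fixes n m :: nat and ms ls \<gamma> :: "nat \<Rightarrow> nat" and \<mu> :: "nat \<Rightarrow> nat list"
    and j :: int and \<sigma> :: "nat \<Rightarrow> nat"
  assumes "n \<ge> 1"
    and "\<And>h. h \<in> {1..n} \<Longrightarrow> ms h > 0"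
    and "\<And>h. h \<in> {1..n} \<Longrightarrow> ls h > 0"
    and "m = (\<Sum>h\<in>{1..n}. ms h)"
    and "multi_partition_of n ls \<mu> ms"
    and "\<And>h. h \<in> {1..n} \<Longrightarrow>
           \<gamma> h = group.ord (sym_group (ms h)) (a_perm1 (\<mu> h) (ls h) [^]\<^bsub>sym_group (ms h)\<^esub> j)"
    and "\<sigma> \<in> carrier (sym_group m)"
  shows "\<exists>f. bij_betw f
           {X \<in> tabloids n \<mu>. left_tabloid n \<mu> \<sigma> X =
              right_tabloid n \<mu> X (a_perm n \<mu> ls [^]\<^bsub>sym_group m\<^esub> (- j))}
           (marked_tabloids (cycle_type m \<sigma>) \<gamma> n ls \<mu>)"
proof -
  have l_partition: "l_partition_of (ls h) (\<mu> h) (ms h)" and sum_list: "sum_list (\<mu> h) = ms h"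
    if "h \<in> {1..n}" for h
    using assms(5) that by (auto simp: multi_partition_of_def l_partition_of_def partition_of_def)
  then have size: "total_size n \<mu> = m"
    by (simp add: total_size_def assms(4))
  have \<sigma>: "\<sigma> permutes {1..m}"
    using assms(7) by (simp add: sym_group_carrier)
  interpret rotated_multipartition n ls \<mu> j \<gamma> "cycle_type m \<sigma>"
  proof unfold_locales
    show "\<gamma> h = ls h div gcd (ls h) (nat \<bar>j\<bar>)" if "h \<in> {1..n}" for h
      using assms(2,3,6) l_partition that by (simp add: ord_a_perm1_int_pow)
  qed (use assms l_partition sum_list cycle_type_pos[OF \<sigma>] in auto)
  obtain f where
    "bij_betw f {R \<in> rowmaps. \<forall>y\<in>{1..m}. R (\<sigma> y) = row_shift (- j) (R y)} assignments"
    using bij_betw_assignments \<sigma> unfolding size by blast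
  from bij_betw_trans[OF bij_betw_trans[OF bij_betw_inv_into[OF
        bij_betw_fixed_tabloids[unfolded size, OF \<sigma>]] this] bij_betw_marked_tabloids]
  show ?thesis
    by blast
qed

end
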